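(* For each $n$ consider the random intersection graph with communities $\mathrm{RIGC}(\boldsymbol d^{l},\mathbf{Com})$, under conditions (A)–(D) of the context. In addition, assume that, as $n\to\infty$, $\mathbb E[(D_n^l)^2]\to\mathbb E[(D^l)^2]<\infty$. Let $V_n^r$ be uniform on the set of communities $[M_n]$, independent of the random matching $\omega_n$. Then, as $n\to\infty$, the average number of communities overlapping with a typical one converges: $$\frac{2|\mathscr L_1|}{M_n}=\mathbb E\big[|\mathscr N(V_n^r)|\,\big|\,\omega_n\big]\xrightarrow{\ \mathbb P\ }\mathbb E[D^r]\,\mathbb E[\widetilde D^{l}].$$
   Context: **Model.** For each $n$: individuals $\mathscr V^{l}=[N_n]$ and communities $\mathscr V^{r}=[M_n]$ (treated as disjoint sets), with $N_n,M_n\to\infty$. Each individual $v$ has a number of memberships ($l$-degree) $d^{l}_v\ge 1$. Let $\mathscr H$ be the set of non-empty, simple, finite, connected graphs, one representative per isomorphism class, with $H\in\mathscr H$ having vertex set $[|H|]$. Each community $a$ has a community graph $\mathrm{Com}_a\in\mathscr H$, and $r$-degree $d^{r}_a=|\mathrm{Com}_a|\ge1$. Assume $h_n:=\sum_{v}d^{l}_v=\sum_a d^{r}_a$. Individual $v$ has $l$-half-edges $(v,i)$, $i\in[d^l_v]$; community $a$ has $r$-half-edges $(a,k)$, $k\in[d^r_a]$, the half-edge $(a,k)$ representing the vertex of $\mathrm{Com}_a$ labelled $k$ (a "community role"). Let $\omega_n$ be a uniformly random bijection between $l$-half-edges and $r$-half-edges. If $(v,i)$ is matched to $(a,k)$ we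 say $v$ takes the role $j=(a,k)$. $\mathrm{RIGC}(\boldsymbol d^l,\mathbf{Com})$ is the random multigraph on $\mathscr V^l$ obtained by adding, for every community $a$ and every edge $\{j_1,j_2\}$ of $\mathrm{Com}_a$, one edge between the individuals taking roles $j_1$ and $j_2$. **Overlaps.** Individual $v$ is part of community $a$ if $v$ takes at least one role of $\mathrm{Com}_a$. For communities $a\ne b$, the overlap size $\mathscr O(a,b)$ is the number of individuals that are part of both $a$ and $b$. $\mathscr N(a)=\{b\in[M_n]: b\ne a,\ \mathscr O(a,b)\ge1\}$, and $\mathscr L_1$ is the set of unordered pairs $\{a,b\}$ of distinct communities with $\mathscr O(a,b)\ge1$. **Assumptions.** Let $D_n^l=d^l_{V}$ with $V$ uniform on $[N_n]$, $D_n^r=d^r_{A}$ with $A$ uniform on $[M_n]$, and $\mu^{(n)}_H=|\{a:\mathrm{Com}_a=H\}|/M_n$ for $H\in\mathscr H$. (A) $D_n^l$ converges in distribution to a random variable $D^l$. (B) $\mathbb E[D_n^l]\to\mathbb E[D^l]<\infty$. (C) There is a probability mass function $\mu$ on $\mathscr H$ with $\mu_H^{(n)}\to\mu_H$ for all $H$; consequently $D_n^r$ converges in distribution to $D^r$ with pmf $q_k=\sum_{|H|=k}\mu_H$. (D) $\mathbb E[D_n^r]\to\mathbb E[D^r]<\infty$. $\widetilde D^l$ has pmf $\mathbb P(\widetilde D^l=k)=(k+1)\mathbb P(D^l=k+1)/\mathbb E[D^l]$, $k=0,1,2,\dots$. *)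

theory Defs
  imports "HOL-Probability.Probability"
begin

section \<open>Community graphs\<close>

text \<open>A pair \<open>(k, E)\<close> stands for the graph with vertex set \<open>{1..k}\<close> and set \<open>E\<close> of
  unordered edges.\<close>

type_synonym com_graph = "nat \<times> nat set set"

abbreviation gsize :: "com_graph \<Rightarrow> nat" where
  "gsize G \<equiv> fst G"

abbreviation gverts :: "com_graph \<Rightarrow> nat set" where
  "gverts G \<equiv> {1..gsize G}"

abbreviation gedges :: "com_graph \<Rightarrow> nat set set" where
  "gedges G \<equiv> snd G"

definition simple_graph :: "com_graph \<Rightarrow> bool" where
  "simple_graph G \<longleftrightarrow> (\<forall>e\<in>gedges G. e \<subseteq> gverts G \<and> card e = 2)"

definition connected_graph :: "com_graph \<Rightarrow> bool" where
  "connected_graph G \<longleftrightarrow>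
     (\<forall>u\<in>gverts G. \<forall>v\<in>gverts G. (u, v) \<in> {(x, y). {x, y} \<in> gedges G}\<^sup>*)"

definition graph_iso :: "com_graph \<Rightarrow> com_graph \<Rightarrow> bool" where
  "graph_iso G H \<longleftrightarrow>
     (\<exists>f. bij_betw f (gverts G) (gverts H) \<and>
          (\<forall>u\<in>gverts G. \<forall>v\<in>gverts G. {u, v} \<in> gedges G \<longleftrightarrow> {f u, f v} \<in> gedges H))"

definition admissible :: "com_graph \<Rightarrow> bool" where
  "admissible G \<longleftrightarrow> gsize G \<ge> 1 \<and> simple_graph G \<and> connected_graph G"

text \<open>Every finite graph is isomorphic to one on some \<open>{1..k}\<close>, so such a set contains exactly
  one graph from each isomorphism class of non-empty finite simple connected graphs.\<close>

definition iso_representatives :: "com_graph set \<Rightarrow> bool" where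
  "iso_representatives \<H> \<longleftrightarrow>
     \<H> \<subseteq> Collect admissible \<and> (\<forall>G. admissible G \<longrightarrow> (\<exists>!H. H \<in> \<H> \<and> graph_iso G H))"


section \<open>Half-edges, matchings and overlaps\<close>

text \<open>The individuals are \<open>{1..N}\<close> with \<open>l\<close>-degrees \<open>dl\<close>, the communities are \<open>{1..M}\<close> with
  \<open>r\<close>-degrees \<open>dr\<close>. The overlaps depend on the community graphs only through \<open>dr\<close>; the edges of
  the resulting multigraph do not enter.\<close>

definition half_edges :: "nat \<Rightarrow> (nat \<Rightarrow> nat) \<Rightarrow> (nat \<times> nat) set" where
  "half_edges K d = (SIGMA x:{1..K}. {1..d x})"

type_synonym matching = "nat \<times> nat \<Rightarrow> nat \<times> nat"

text \<open>Extensionality makes distinct elements of this set distinct as bijections, so that counting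
  them (and hence the uniform distribution) is meaningful.\<close>

definition matchings :: "nat \<Rightarrow> (nat \<Rightarrow> nat) \<Rightarrow> nat \<Rightarrow> (nat \<Rightarrow> nat) \<Rightarrow> matching set" where
  "matchings N dl M dr =
     {w \<in> half_edges N dl \<rightarrow>\<^sub>E half_edges M dr. bij_betw w (half_edges N dl) (half_edges M dr)}"

definition part_of :: "(nat \<Rightarrow> nat) \<Rightarrow> (nat \<Rightarrow> nat) \<Rightarrow> matching \<Rightarrow> nat \<Rightarrow> nat \<Rightarrow> bool" where
  "part_of dl dr w v a \<longleftrightarrow> (\<exists>i\<in>{1..dl v}. \<exists>k\<in>{1..dr a}. w (v, i) = (a, k))"

definition overlap :: "nat \<Rightarrow> (nat \<Rightarrow> nat) \<Rightarrow> (nat \<Rightarrow> nat) \<Rightarrow> matching \<Rightarrow> nat \<Rightarrow> nat \<Rightarrow> nat" where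
  "overlap N dl dr w a b = card {v \<in> {1..N}. part_of dl dr w v a \<and> part_of dl dr w v b}"

definition neighbours ::
    "nat \<Rightarrow> (nat \<Rightarrow> nat) \<Rightarrow> nat \<Rightarrow> (nat \<Rightarrow> nat) \<Rightarrow> matching \<Rightarrow> nat \<Rightarrow> nat set" where
  "neighbours N dl M dr w a = {b \<in> {1..M}. b \<noteq> a \<and> overlap N dl dr w a b \<ge> 1}"

definition overlapping_pairs ::
    "nat \<Rightarrow> (nat \<Rightarrow> nat) \<Rightarrow> nat \<Rightarrow> (nat \<Rightarrow> nat) \<Rightarrow> matching \<Rightarrow> nat set set" where
  "overlapping_pairs N dl M dr w =
     {{a, b} | a b. a \<in> {1..M} \<and> b \<in> {1..M} \<and> a \<noteq> b \<and> overlap N dl dr w a b \<ge> 1}"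


section \<open>Probabilistic notions\<close>

text \<open>The law of \<open>d U\<close> with \<open>U\<close> uniform on \<open>{1..K}\<close> (meaningful for \<open>K \<ge> 1\<close>).\<close>

definition degree_law :: "nat \<Rightarrow> (nat \<Rightarrow> nat) \<Rightarrow> nat pmf" where
  "degree_law K d = map_pmf d (pmf_of_set {1..K})"

definition conv_in_distribution :: "(nat \<Rightarrow> nat pmf) \<Rightarrow> nat pmf \<Rightarrow> bool" where
  "conv_in_distribution p q \<longleftrightarrow>
     weak_conv_m (\<lambda>n. distr (measure_pmf (p n)) borel real) (distr (measure_pmf q) borel real)"

text \<open>Each \<open>X n\<close> may live on its own probability space.\<close>

definition conv_in_probability ::
    "(nat \<Rightarrow> 'a measure) \<Rightarrow> (nat \<Rightarrow> 'a \<Rightarrow> real) \<Rightarrow> real \<Rightarrow> bool" where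
  "conv_in_probability P X c \<longleftrightarrow>
     (\<forall>n. X n \<in> borel_measurable (P n)) \<and>
     (\<forall>\<epsilon>>0. (\<lambda>n. measure (P n) {x \<in> space (P n). \<bar>X n x - c\<bar> > \<epsilon>}) \<longlonglongrightarrow> 0)"

text \<open>The conditional expectation of \<open>f\<close> given the sigma-algebra generated by the random element
  \<open>X\<close> with values in \<open>S\<close>.\<close>

definition cond_exp_given ::
    "'a measure \<Rightarrow> 'b measure \<Rightarrow> ('a \<Rightarrow> 'b) \<Rightarrow> ('a \<Rightarrow> real) \<Rightarrow> 'a \<Rightarrow> real" where
  "cond_exp_given P S X f = real_cond_exp P (vimage_algebra (space P) X S) f"

text \<open>Independence of two random elements whose value types may differ (\<open>indep_var\<close> requires
  equal types): their generated sigma-algebras are independent.\<close>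

definition indep_elements ::
    "'a measure \<Rightarrow> 'b measure \<Rightarrow> ('a \<Rightarrow> 'b) \<Rightarrow> 'c measure \<Rightarrow> ('a \<Rightarrow> 'c) \<Rightarrow> bool" where
  "indep_elements P S X T Y \<longleftrightarrow>
     X \<in> measurable P S \<and> Y \<in> measurable P T \<and>
     prob_space.indep_set P (sets (vimage_algebra (space P) X S)) (sets (vimage_algebra (space P) Y T))"

end

theory Submission
  imports Defs
begin

text \<open>Every overlapping ordered pair of communities is witnessed by a \<^emph>\<open>sibling pair\<close>: an ordered
  pair of distinct half-edges of one individual. Hence twice the number of overlapping pairs is at
  most the deterministic number \<open>T = (\<Sum>v. d\<^sub>v (d\<^sub>v - 1))\<close> of sibling pairs, and \<open>T / M\<close> tends to the
  claimed limit. As the deficit is non-negative, Markov's inequality reduces the theorem to showing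
  that its expectation is \<open>o(M)\<close>; no second moment of the number of overlaps is needed. Since the
  community sizes have only a first moment, the expectation is bounded after truncating both degree
  sequences at \<open>K\<close>: sibling pairs with a large individual or a large community are rare by uniform
  integrability, and for fixed \<open>K\<close> the remaining losses (both half-edges in one community, or two
  sibling pairs with the same pair of communities) are bounded.\<close>

section \<open>Uniform bijections\<close>

text \<open>Stated for arbitrary sets rather than sets of half-edges, because fixing some values
  leaves a bijection between complements.\<close>

definition bijections :: "'a set \<Rightarrow> 'b set \<Rightarrow> ('a \<Rightarrow> 'b) set" where
  "bijections A B = {w \<in> A \<rightarrow>\<^sub>E B. bij_betw w A B}"

lemma finite_bijections [simp]: "finite A \<Longrightarrow> finite B \<Longrightarrow> finite (bijections A B)"
  by (rule finite_subset[of _ "A \<rightarrow>\<^sub>E B"]) (auto simp: bijections_def intro: finite_PiE)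

text \<open>Restriction to \<open>A - D\<close> forgets nothing, since the values on
  \<open>D\<close> are prescribed; \<open>ext\<close> glues them back on and is the inverse.\<close>

lemma card_bijections_extending:
  assumes "D \<subseteq> A" "inj_on g D" "g ` D \<subseteq> B"
  shows "card {w \<in> bijections A B. \<forall>x\<in>D. w x = g x} = card (bijections (A - D) (B - g ` D))"
proof -
  define ext where "ext = (\<lambda>u x. if x \<in> D then g x else u x)"
  have "bij_betw (\<lambda>w. restrict w (A - D)) {w \<in> bijections A B. \<forall>x\<in>D. w x = g x}
      (bijections (A - D) (B - g ` D))"
  proof (rule bij_betw_byWitness[where f' = ext])
    show "\<forall>w\<in>{w \<in> bijections A B. \<forall>x\<in>D. w x = g x}. ext (restrict w (A - D)) = w"
      by (auto simp: ext_def bijections_def PiE_def extensional_def fun_eq_iff)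
    show "\<forall>u\<in>bijections (A - D) (B - g ` D). restrict (ext u) (A - D) = u"
      by (auto simp: ext_def bijections_def PiE_def extensional_def fun_eq_iff restrict_def)
    show "(\<lambda>w. restrict w (A - D)) ` {w \<in> bijections A B. \<forall>x\<in>D. w x = g x}
        \<subseteq> bijections (A - D) (B - g ` D)"
    proof clarify
      fix w assume w: "w \<in> bijections A B" and g: "\<forall>x\<in>D. w x = g x"
      have bij: "bij_betw w A B" using w by (simp add: bijections_def)
      have "w ` (A - D) = B - g ` D"
        using bij assms(1) g inj_on_image_set_diff[of w A A D] by (auto simp: bij_betw_def)
      then have "bij_betw w (A - D) (B - g ` D)"
        using bij by (auto simp: bij_betw_def intro: inj_on_subset)
      then show "restrict w (A - D) \<in> bijections (A - D) (B - g ` D)"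
        by (auto simp: bijections_def bij_betw_def)
    qed
    show "ext ` bijections (A - D) (B - g ` D) \<subseteq> {w \<in> bijections A B. \<forall>x\<in>D. w x = g x}"
    proof clarify
      fix u assume u: "u \<in> bijections (A - D) (B - g ` D)"
      have "bij_betw (ext u) (D \<union> (A - D)) (g ` D \<union> (B - g ` D))"
      proof (rule bij_betw_combine)
        show "bij_betw (ext u) D (g ` D)"
          using assms(2) by (auto simp: bij_betw_def ext_def inj_on_def)
        have "bij_betw u (A - D) (B - g ` D)" using u by (simp add: bijections_def)
        then show "bij_betw (ext u) (A - D) (B - g ` D)"
          by (subst bij_betw_cong[of _ _ u]) (auto simp: ext_def)
      qed auto
      moreover have "D \<union> (A - D) = A" "g ` D \<union> (B - g ` D) = B" using assms by auto
      ultimately have bij: "bij_betw (ext u) A B" by simp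
      have "ext u \<in> extensional A"
        using u assms(1) by (auto simp: bijections_def ext_def PiE_def extensional_def)
      then have "ext u \<in> bijections A B"
        using bij by (auto simp: bijections_def PiE_def bij_betw_def)
      then show "ext u \<in> bijections A B \<and> (\<forall>x\<in>D. ext u x = g x)"
        by (simp add: ext_def)
    qed
  qed
  then show ?thesis by (rule bij_betw_same_card)
qed

text \<open>Induction on \<open>A\<close>: splitting by the image \<open>y\<close> of the new
  element leaves the bijections from the old set to \<open>B - {y}\<close>.\<close>

lemma card_bijections:
  assumes "finite A" "finite B" "card A = card B"
  shows "card (bijections A B) = fact (card A)"
  using assms
proof (induction A arbitrary: B rule: finite_induct)
  case empty
  then show ?case by (simp add: bijections_def bij_betw_def)
next
  case (insert x A)
  have "bijections (insert x A) B = (\<Union>y\<in>B. {w \<in> bijections (insert x A) B. \<forall>z\<in>{x}. w z = y})"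
    by (auto simp: bijections_def)
  also have "card \<dots> = (\<Sum>y\<in>B. card {w \<in> bijections (insert x A) B. \<forall>z\<in>{x}. w z = y})"
    using insert by (intro card_UN_disjoint) auto
  also have "\<dots> = (\<Sum>y\<in>B. fact (card A))"
  proof (rule sum.cong)
    fix y assume y: "y \<in> B"
    have "card {w \<in> bijections (insert x A) B. \<forall>z\<in>{x}. w z = y} = card (bijections A (B - {y}))"
      using card_bijections_extending[of "{x}" "insert x A" "\<lambda>_. y" B] y insert.hyps by simp
    also have "\<dots> = fact (card A)"
      by (rule insert.IH) (use insert.prems insert.hyps y in auto)
    finally show "card {w \<in> bijections (insert x A) B. \<forall>z\<in>{x}. w z = y} = fact (card A)" .
  qed simp
  finally have "card (bijections (insert x A) B) = card B * fact (card A)" by simp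
  also have "card B = Suc (card A)" using insert.hyps insert.prems by simp
  finally show ?case using insert.hyps by simp
qed

text \<open>The estimates for the uniform matching rest on this count. A list attained by some
  bijection is attained by exactly \<open>fact (card A - length xs)\<close> of them, a list attained
  by none contributes nothing, and a union bound over \<open>S\<close> finishes.\<close>

lemma card_bijections_map_in:
  assumes "finite A" "finite B" "card A = card B"
    and xs: "distinct xs" "set xs \<subseteq> A" and S: "finite S"
  shows "card {w \<in> bijections A B. map w xs \<in> S} \<le> card S * fact (card A - length xs)"
proof -
  have single: "card {w \<in> bijections A B. map w xs = ys} \<le> fact (card A - length xs)" for ys
  proof (cases "\<exists>w\<in>bijections A B. map w xs = ys")
    case True
    \<comment> \<open>A bijection attaining \<open>ys\<close> serves as the prescription itself, so
      its injectivity and range come for free.\<close>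
    then obtain g where g: "g \<in> bijections A B" "map g xs = ys" by auto
    have inj: "inj_on g (set xs)" "g ` set xs \<subseteq> B"
      using g xs by (auto simp: bijections_def bij_betw_def intro: inj_on_subset)
    have "{w \<in> bijections A B. map w xs = ys} = {w \<in> bijections A B. \<forall>x\<in>set xs. w x = g x}"
      using g by auto
    also have "card \<dots> = card (bijections (A - set xs) (B - g ` set xs))"
      by (rule card_bijections_extending) (use xs inj in auto)
    also have "\<dots> = fact (card A - length xs)"
      using assms inj by (subst card_bijections)
        (auto simp: card_Diff_subset finite_subset card_image distinct_card)
    finally show ?thesis by simp
  next
    case False
    then have "{w \<in> bijections A B. map w xs = ys} = {}" by auto
    then show ?thesis by (metis card.empty le0)
  qed
  have "{w \<in> bijections A B. map w xs \<in> S} = (\<Union>ys\<in>S. {w \<in> bijections A B. map w xs = ys})"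
    by auto
  then have "card {w \<in> bijections A B. map w xs \<in> S}
      \<le> (\<Sum>ys\<in>S. card {w \<in> bijections A B. map w xs = ys})"
    using S by (simp add: card_UN_le)
  also have "\<dots> \<le> (\<Sum>ys\<in>S. fact (card A - length xs))"
    by (intro sum_mono single)
  finally show ?thesis by simp
qed

section \<open>Double counting and collisions of a finite map\<close>

lemma sum_card_swap:
  assumes "finite A" "finite B"
  shows "(\<Sum>x\<in>A. card {y \<in> B. Q x y}) = (\<Sum>y\<in>B. card {x \<in> A. Q x y})"
proof -
  have "(\<Sum>x\<in>A. card {y \<in> B. Q x y}) = (\<Sum>x\<in>A. \<Sum>y\<in>B. if Q x y then 1 else 0)"
    using assms by (simp add: sum.inter_filter[symmetric])
  also have "\<dots> = (\<Sum>y\<in>B. \<Sum>x\<in>A. if Q x y then 1 else 0)"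
    by (rule sum.swap)
  also have "\<dots> = (\<Sum>y\<in>B. card {x \<in> A. Q x y})"
    using assms by (simp add: sum.inter_filter[symmetric])
  finally show ?thesis .
qed

text \<open>\<open>inv_into S f (f p)\<close> is a chosen representative of the fibre of
  \<open>p\<close>. Any \<open>p\<close> other than its representative collides with it and is
  recovered as the second component of that collision.\<close>

lemma card_le_card_image_plus_collisions:
  assumes "finite S"
  shows "card S \<le> card (f ` S) + card {(p, q). p \<in> S \<and> q \<in> S \<and> p \<noteq> q \<and> f p = f q}"
proof -
  let ?C = "{(p, q). p \<in> S \<and> q \<in> S \<and> p \<noteq> q \<and> f p = f q}"
  have fin: "finite ?C" by (rule finite_subset[of _ "S \<times> S"]) (use assms in auto)
  have "S \<subseteq> inv_into S f ` f ` S \<union> snd ` ?C"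
  proof
    fix p assume p: "p \<in> S"
    show "p \<in> inv_into S f ` f ` S \<union> snd ` ?C"
    proof (cases "inv_into S f (f p) = p")
      case True
      then have "p \<in> inv_into S f ` f ` S" using p by (intro image_eqI[of p _ "f p"]) simp_all
      then show ?thesis by simp
    next
      case False
      moreover have "inv_into S f (f p) \<in> S" "f (inv_into S f (f p)) = f p"
        using p by (simp_all add: inv_into_into f_inv_into_f)
      ultimately have "(inv_into S f (f p), p) \<in> ?C" using p by simp
      then have "p \<in> snd ` ?C" by (rule image_eqI[rotated]) simp
      then show ?thesis by simp
    qed
  qed
  then have "card S \<le> card (inv_into S f ` f ` S \<union> snd ` ?C)"
    by (rule card_mono[rotated]) (use assms fin in auto)
  also have "\<dots> \<le> card (inv_into S f ` f ` S) + card (snd ` ?C)" by (rule card_Un_le)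
  also have "\<dots> \<le> card (f ` S) + card ?C"
    by (intro add_mono card_image_le) (use assms fin in auto)
  finally show ?thesis .
qed

section \<open>Sibling pairs and overlaps\<close>

lemma square_times_fact_le:
  fixes h :: nat
  assumes "h \<ge> 6"
  shows "h\<^sup>2 * fact (h - 2) \<le> 2 * fact h"
proof -
  obtain m where h: "h = m + 6" using assms by (metis add.commute le_Suc_ex)
  have "(m + 6)\<^sup>2 \<le> 2 * ((m + 6) * (m + 5))" by (simp add: power2_eq_square algebra_simps)
  then have "(m + 6)\<^sup>2 * fact (m + 4) \<le> 2 * ((m + 6) * (m + 5)) * fact (m + 4)"
    by (rule mult_right_mono) simp
  also have "\<dots> = 2 * fact (m + 6)" by (simp add: fact_reduce algebra_simps)
  finally have "(m + 6)\<^sup>2 * fact (m + 4) \<le> 2 * fact (m + 6)" .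
  moreover have "h - 2 = m + 4" using h by simp
  ultimately show ?thesis using h by metis
qed

text \<open>The quotient of h^4 by h (h - 1) (h - 2) (h - 3) is at most 8, since h is at most twice
  each of the last three factors. For h - 3 this means that h is at least 6, the source of the
  threshold.\<close>

lemma power4_times_fact_le:
  fixes h :: nat
  assumes "h \<ge> 6"
  shows "h ^ 4 * fact (h - 4) \<le> 8 * fact h"
proof -
  obtain m where h: "h = m + 6" using assms by (metis add.commute le_Suc_ex)
  have "(m + 6) * ((m + 6) * ((m + 6) * (m + 6)))
      \<le> (m + 6) * ((2 * (m + 5)) * ((2 * (m + 4)) * (2 * (m + 3))))"
    by (intro mult_mono) auto
  then have "(m + 6) * ((m + 6) * ((m + 6) * (m + 6))) * fact (m + 2)
      \<le> (m + 6) * ((2 * (m + 5)) * ((2 * (m + 4)) * (2 * (m + 3)))) * fact (m + 2)"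
    by (rule mult_right_mono) simp
  also have "\<dots> = 8 * ((m + 6) * ((m + 5) * ((m + 4) * ((m + 3) * fact (m + 2)))))"
    by (simp only: mult.assoc mult.left_commute)
  also have "(m + 3) * fact (m + 2) = fact (m + 3)" by (simp add: fact_reduce)
  also have "(m + 4) * fact (m + 3) = fact (m + 4)" by (simp add: fact_reduce)
  also have "(m + 5) * fact (m + 4) = fact (m + 5)" by (simp add: fact_reduce)
  also have "(m + 6) * fact (m + 5) = fact (m + 6)" by (simp add: fact_reduce)
  finally have "(m + 6) ^ 4 * fact (m + 2) \<le> 8 * fact (m + 6)"
    by (simp only: power4_eq_xxxx mult.assoc)
  moreover have "h - 4 = m + 2" using h by simp
  ultimately show ?thesis using h by metis
qed

section \<open>Counting half-edges, sibling pairs and colocated roles\<close>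

lemma finite_half_edges [simp]: "finite (half_edges K d)"
  by (simp add: half_edges_def)

lemma card_half_edges_filter:
  "card {x \<in> half_edges K d. Q (fst x)} = (\<Sum>v | v \<in> {1..K} \<and> Q v. d v)"
proof -
  have "{x \<in> half_edges K d. Q (fst x)} = (SIGMA v:{v \<in> {1..K}. Q v}. {1..d v})"
    by (auto simp: half_edges_def)
  then show ?thesis by simp
qed

lemma card_half_edges: "card (half_edges K d) = (\<Sum>v=1..K. d v)"
  by (simp add: half_edges_def)

definition sibling_pairs :: "nat \<Rightarrow> (nat \<Rightarrow> nat) \<Rightarrow> ((nat \<times> nat) \<times> (nat \<times> nat)) set" where
  "sibling_pairs K d =
     {(x, y). x \<in> half_edges K d \<and> y \<in> half_edges K d \<and> fst x = fst y \<and> x \<noteq> y}"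

lemma finite_sibling_pairs [simp]: "finite (sibling_pairs K d)"
  by (rule finite_subset[of _ "half_edges K d \<times> half_edges K d"]) (auto simp: sibling_pairs_def)

text \<open>Fibring the pairs over their first half-edge leaves \<open>d v - 1\<close> choices for
  the second. The truncated subtraction is harmless at \<open>d v = 0\<close>, where the product
  vanishes.\<close>

lemma card_sibling_pairs_filter:
  "card {p \<in> sibling_pairs K d. Q (fst (fst p))} = (\<Sum>v | v \<in> {1..K} \<and> Q v. d v * (d v - 1))"
proof -
  have "{p \<in> sibling_pairs K d. Q (fst (fst p))}
      = (SIGMA x:(SIGMA v:{v \<in> {1..K}. Q v}. {1..d v}). {fst x} \<times> {1..d (fst x)} - {x})"
    by (auto simp: sibling_pairs_def half_edges_def)
  also have "card \<dots> = (\<Sum>x\<in>(SIGMA v:{v \<in> {1..K}. Q v}. {1..d v}). d (fst x) - 1)"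
    by (subst card_SigmaI) (auto intro!: sum.cong simp: card_Diff_singleton_if)
  also have "\<dots> = (\<Sum>v | v \<in> {1..K} \<and> Q v. \<Sum>i\<in>{1..d v}. d v - 1)"
    by (subst sum.Sigma) (auto simp: case_prod_unfold)
  finally show ?thesis by simp
qed

lemma card_sibling_pairs: "card (sibling_pairs K d) = (\<Sum>v=1..K. d v * (d v - 1))"
  using card_sibling_pairs_filter[of K d "\<lambda>_. True"] by (simp only: simp_thms Collect_mem_eq)

text \<open>After this truncation the number of sibling pairs, and of partners of a given one at the
  same individual, is controlled by \<open>K\<close> and the number of half-edges alone.\<close>

definition small_sibling_pairs ::
    "nat \<Rightarrow> nat \<Rightarrow> (nat \<Rightarrow> nat) \<Rightarrow> ((nat \<times> nat) \<times> (nat \<times> nat)) set" where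
  "small_sibling_pairs K N dl = {p \<in> sibling_pairs N dl. dl (fst (fst p)) \<le> K}"

lemma finite_small_sibling_pairs [simp]: "finite (small_sibling_pairs K N dl)"
  by (simp add: small_sibling_pairs_def)

lemma card_sibling_pairs_small:
  "card (small_sibling_pairs K N dl) \<le> card (half_edges N dl) * K"
proof -
  have "card (small_sibling_pairs K N dl) = (\<Sum>v | v \<in> {1..N} \<and> dl v \<le> K. dl v * (dl v - 1))"
    unfolding small_sibling_pairs_def by (rule card_sibling_pairs_filter)
  also have "\<dots> \<le> (\<Sum>v | v \<in> {1..N} \<and> dl v \<le> K. dl v * K)"
    by (intro sum_mono mult_left_mono) auto
  also have "\<dots> \<le> (\<Sum>v=1..N. dl v * K)" by (intro sum_mono2) auto
  finally show ?thesis by (simp add: card_half_edges sum_distrib_right)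
qed

text \<open>Turns the event that two half-edges meet in one small community into membership of their
  images in a fixed set, the form treated by \<open>card_bijections_map_in\<close>. The diagonal is
  included so that a role of community \<open>a\<close> has exactly \<open>dr a\<close>
  partners.\<close>

definition colocated_roles ::
    "nat \<Rightarrow> nat \<Rightarrow> (nat \<Rightarrow> nat) \<Rightarrow> ((nat \<times> nat) \<times> (nat \<times> nat)) set" where
  "colocated_roles K M dr =
     {(r, s). r \<in> half_edges M dr \<and> s \<in> half_edges M dr \<and> fst r = fst s \<and> dr (fst r) \<le> K}"

lemma finite_colocated_roles [simp]: "finite (colocated_roles K M dr)"
  by (rule finite_subset[of _ "half_edges M dr \<times> half_edges M dr"])
    (auto simp: colocated_roles_def)

lemma card_colocated_roles:
  "card (colocated_roles K M dr) \<le> card (half_edges M dr) * K"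
proof -
  have "colocated_roles K M dr
      = (SIGMA r:{r \<in> half_edges M dr. dr (fst r) \<le> K}. {fst r} \<times> {1..dr (fst r)})"
    by (auto simp: colocated_roles_def half_edges_def)
  also have "card \<dots> = (\<Sum>r | r \<in> half_edges M dr \<and> dr (fst r) \<le> K. dr (fst r))"
    by (subst card_SigmaI) auto
  also have "\<dots> \<le> (\<Sum>r | r \<in> half_edges M dr \<and> dr (fst r) \<le> K. K)"
    by (intro sum_mono) auto
  also have "\<dots> \<le> card (half_edges M dr) * K"
    by (auto intro: card_mono)
  finally show ?thesis .
qed

section \<open>Overlapping pairs as images of sibling pairs\<close>

definition ordered_overlapping_pairs ::
    "nat \<Rightarrow> (nat \<Rightarrow> nat) \<Rightarrow> nat \<Rightarrow> (nat \<Rightarrow> nat) \<Rightarrow> matching \<Rightarrow> (nat \<times> nat) set" where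
  "ordered_overlapping_pairs N dl M dr w = (SIGMA a:{1..M}. neighbours N dl M dr w a)"

lemma finite_neighbours [simp]: "finite (neighbours N dl M dr w a)"
  by (simp add: neighbours_def)

lemma finite_ordered_overlapping_pairs [simp]: "finite (ordered_overlapping_pairs N dl M dr w)"
  by (simp add: ordered_overlapping_pairs_def)

lemma card_ordered_overlapping_pairs:
  "card (ordered_overlapping_pairs N dl M dr w) = (\<Sum>a=1..M. card (neighbours N dl M dr w a))"
  by (simp add: ordered_overlapping_pairs_def)

lemma overlap_commute: "overlap N dl dr w a b = overlap N dl dr w b a"
  unfolding overlap_def by (rule arg_cong[of _ _ card]) auto

text \<open>Swapping components exchanges the pairs with \<open>a < b\<close> and those with
  \<open>b < a\<close>, and each unordered pair has exactly one increasing ordering.\<close>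

lemma card_ordered_eq_twice_overlapping:
  "card (ordered_overlapping_pairs N dl M dr w) = 2 * card (overlapping_pairs N dl M dr w)"
proof -
  let ?O = "ordered_overlapping_pairs N dl M dr w"
  let ?U = "{(a, b) \<in> ?O. a < b}" and ?D = "{(a, b) \<in> ?O. b < a}"
  have sym: "(a, b) \<in> ?O \<longleftrightarrow> (b, a) \<in> ?O" for a b
    by (auto simp: ordered_overlapping_pairs_def neighbours_def overlap_commute[of _ _ _ _ a b])
  have neq: "a \<noteq> b" if "(a, b) \<in> ?O" for a b
    using that by (auto simp: ordered_overlapping_pairs_def neighbours_def)
  have fin: "finite ?U" "finite ?D"
    by (rule finite_subset[of _ ?O]; auto)+
  have "?O = ?U \<union> ?D" using neq by (auto simp: neq_iff)
  moreover have "card (?U \<union> ?D) = card ?U + card ?D"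
    by (rule card_Un_disjoint) (use fin in auto)
  ultimately have "card ?O = card ?U + card ?D" by simp
  moreover have "card ?D = card ?U"
    by (rule bij_betw_same_card[of prod.swap], rule bij_betw_byWitness[where f' = prod.swap])
      (use sym in auto)
  moreover have "overlapping_pairs N dl M dr w = (\<lambda>(a, b). {a, b}) ` ?U"
  proof
    show "overlapping_pairs N dl M dr w \<subseteq> (\<lambda>(a, b). {a, b}) ` ?U"
    proof
      fix e assume "e \<in> overlapping_pairs N dl M dr w"
      then obtain a b where e: "e = {a, b}" and ab: "(a, b) \<in> ?O" "(b, a) \<in> ?O"
        using sym by (auto simp: overlapping_pairs_def ordered_overlapping_pairs_def neighbours_def)
      show "e \<in> (\<lambda>(a, b). {a, b}) ` ?U"
      proof (cases "a < b")
        case True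
        then show ?thesis using e ab by (intro image_eqI[of _ _ "(a, b)"]) auto
      next
        case False
        then have "b < a" using neq[OF ab(1)] by simp
        then show ?thesis using e ab by (intro image_eqI[of _ _ "(b, a)"]) auto
      qed
    qed
    show "(\<lambda>(a, b). {a, b}) ` ?U \<subseteq> overlapping_pairs N dl M dr w"
      by (auto simp: overlapping_pairs_def ordered_overlapping_pairs_def neighbours_def)
  qed
  moreover have "inj_on (\<lambda>(a, b). {a, b}) ?U"
    by (auto simp: inj_on_def doubleton_eq_iff)
  ultimately show ?thesis by (simp add: card_image)
qed

lemma matchings_eq_bijections:
  "matchings N dl M dr = bijections (half_edges N dl) (half_edges M dr)"
  by (simp add: matchings_def bijections_def)

abbreviation communities_of :: "matching \<Rightarrow> (nat \<times> nat) \<times> (nat \<times> nat) \<Rightarrow> nat \<times> nat" where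
  "communities_of w p \<equiv> (fst (w (fst p)), fst (w (snd p)))"

lemma matching_maps_to:
  "w \<in> matchings N dl M dr \<Longrightarrow> x \<in> half_edges N dl \<Longrightarrow> w x \<in> half_edges M dr"
  by (auto simp: matchings_def)

text \<open>An individual in both communities supplies a half-edge for each, and distinct
  communities force distinct half-edges. Conversely, the two half-edges of a sibling pair place
  their individual in both communities.\<close>

lemma ordered_overlapping_pairs_eq_image:
  assumes "w \<in> matchings N dl M dr"
  shows "ordered_overlapping_pairs N dl M dr w
    = communities_of w ` {p \<in> sibling_pairs N dl. fst (w (fst p)) \<noteq> fst (w (snd p))}"
    (is "?O = _ ` ?S")
proof
  show "?O \<subseteq> communities_of w ` ?S"
  proof clarify
    fix a b assume ab: "(a, b) \<in> ?O"
    then have "a \<noteq> b" and "overlap N dl dr w a b \<ge> 1"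
      by (auto simp: ordered_overlapping_pairs_def neighbours_def)
    then have "{v \<in> {1..N}. part_of dl dr w v a \<and> part_of dl dr w v b} \<noteq> {}"
      unfolding overlap_def by (metis card.empty not_one_le_zero)
    then obtain v i j k l where v: "v \<in> {1..N}" "i \<in> {1..dl v}" "j \<in> {1..dl v}"
      "w (v, i) = (a, k)" "w (v, j) = (b, l)"
      unfolding part_of_def by blast
    then have "((v, i), (v, j)) \<in> ?S"
      using \<open>a \<noteq> b\<close> by (auto simp: sibling_pairs_def half_edges_def)
    moreover have "(a, b) = communities_of w ((v, i), (v, j))" using v by simp
    ultimately show "(a, b) \<in> communities_of w ` ?S" by (rule image_eqI[rotated])
  qed
  show "communities_of w ` ?S \<subseteq> ?O"
  proof
    fix c assume "c \<in> communities_of w ` ?S"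
    then obtain x y where xy: "(x, y) \<in> sibling_pairs N dl" "fst (w x) \<noteq> fst (w y)"
      "c = (fst (w x), fst (w y))"
      by auto
    moreover obtain v i where x: "x = (v, i)" by fastforce
    moreover obtain u j where y: "y = (u, j)" by fastforce
    ultimately have v: "v \<in> {1..N}" "i \<in> {1..dl v}" "j \<in> {1..dl v}"
      and ne: "fst (w (v, i)) \<noteq> fst (w (v, j))"
      and c: "c = (fst (w (v, i)), fst (w (v, j)))" and uv: "u = v"
      by (auto simp: sibling_pairs_def half_edges_def)
    obtain a k b l where w: "w (v, i) = (a, k)" "w (v, j) = (b, l)"
      by (metis surj_pair)
    have "w (v, i) \<in> half_edges M dr" "w (v, j) \<in> half_edges M dr"
      using xy(1) x y uv
      by (auto intro!: matching_maps_to[OF assms] simp: sibling_pairs_def)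
    then have ak: "a \<in> {1..M}" "k \<in> {1..dr a}" "b \<in> {1..M}" "l \<in> {1..dr b}"
      using w by (auto simp: half_edges_def)
    have "part_of dl dr w v a" "part_of dl dr w v b"
      unfolding part_of_def using v w ak by blast+
    then have "0 < card {v \<in> {1..N}. part_of dl dr w v a \<and> part_of dl dr w v b}"
      using v by (auto simp: card_gt_0_iff)
    then have "overlap N dl dr w a b \<ge> 1" by (simp add: overlap_def)
    then show "c \<in> ?O"
      using ak c w ne by (auto simp: ordered_overlapping_pairs_def neighbours_def)
  qed
qed

text \<open>Supplies the sign of the deficit that Markov's inequality needs.\<close>

lemma card_ordered_overlapping_pairs_le:
  assumes "w \<in> matchings N dl M dr"
  shows "card (ordered_overlapping_pairs N dl M dr w) \<le> card (sibling_pairs N dl)"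
proof -
  have "card (ordered_overlapping_pairs N dl M dr w)
      \<le> card {p \<in> sibling_pairs N dl. fst (w (fst p)) \<noteq> fst (w (snd p))}"
    unfolding ordered_overlapping_pairs_eq_image[OF assms] by (rule card_image_le) simp
  also have "\<dots> \<le> card (sibling_pairs N dl)" by (rule card_mono) auto
  finally show ?thesis .
qed

text \<open>A sibling pair fails to contribute its own ordered overlap only if its individual is large,
  one of its communities is large, both half-edges lie in one community, or it collides with
  another sibling pair. Collisions within one individual are kept apart, since there the four
  half-edges need not be distinct.\<close>

lemma card_sibling_pairs_le:
  fixes K :: nat
  assumes w: "w \<in> matchings N dl M dr"
  defines "S \<equiv> small_sibling_pairs K N dl" and "C \<equiv> colocated_roles K M dr"
  shows "card (sibling_pairs N dl) \<le> card (ordered_overlapping_pairs N dl M dr w)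
    + card {p \<in> sibling_pairs N dl. dl (fst (fst p)) > K}
    + card {p \<in> sibling_pairs N dl. dr (fst (w (fst p))) > K}
    + card {p \<in> sibling_pairs N dl. dr (fst (w (snd p))) > K}
    + card {p \<in> S. (w (fst p), w (snd p)) \<in> C}
    + card {z \<in> {(p, q). p \<in> S \<and> q \<in> S \<and> p \<noteq> q \<and> fst (fst p) = fst (fst q)}.
        (w (fst (fst z)), w (fst (snd z))) \<in> C \<and> (w (snd (fst z)), w (snd (snd z))) \<in> C}
    + card {z \<in> {(p, q). p \<in> S \<and> q \<in> S \<and> fst (fst p) \<noteq> fst (fst q)}.
        (w (fst (fst z)), w (fst (snd z))) \<in> C \<and> (w (snd (fst z)), w (snd (snd z))) \<in> C}"
    (is "_ \<le> _ + card ?A + card ?B1 + card ?B2 + card ?E + card ?C1 + card ?C2")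
proof -
  let ?T = "sibling_pairs N dl"
  let ?f = "communities_of w"
  \<comment> \<open>Every sibling pair outside \<open>G\<close> lies in one of \<open>?A\<close>,
    \<open>?B1\<close>, \<open>?B2\<close>, \<open>?E\<close>, so inside \<open>G\<close> only
    collisions of \<open>?f\<close> remain to be counted.\<close>
  define G where "G = {p \<in> S. dr (fst (w (fst p))) \<le> K \<and> dr (fst (w (snd p))) \<le> K
      \<and> fst (w (fst p)) \<noteq> fst (w (snd p))}"
  have fin: "finite S" "finite G" by (simp_all add: S_def G_def)
  have inT: "fst p \<in> half_edges N dl" "snd p \<in> half_edges N dl" if "p \<in> ?T" for p
    using that by (auto simp: sibling_pairs_def)
  have ST: "S \<subseteq> ?T" by (auto simp: S_def small_sibling_pairs_def)
  have GS: "G \<subseteq> S" by (auto simp: G_def)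
  have wR: "w (fst p) \<in> half_edges M dr" "w (snd p) \<in> half_edges M dr" if "p \<in> ?T" for p
    using inT[OF that] matching_maps_to[OF w] by auto
  have "?T \<subseteq> G \<union> ?A \<union> ?B1 \<union> ?B2 \<union> ?E"
  proof
    fix p assume p: "p \<in> ?T"
    show "p \<in> G \<union> ?A \<union> ?B1 \<union> ?B2 \<union> ?E"
      using p wR[OF p]
      by (auto simp: G_def S_def small_sibling_pairs_def C_def colocated_roles_def not_le)
  qed
  then have "card ?T \<le> card (G \<union> ?A \<union> ?B1 \<union> ?B2 \<union> ?E)"
    by (rule card_mono[rotated]) (use fin in auto)
  also have "\<dots> \<le> card G + card ?A + card ?B1 + card ?B2 + card ?E"
    by (intro order_trans[OF card_Un_le] add_right_mono order_refl)
  also have "card G \<le> card (?f ` G) + card {(p, q). p \<in> G \<and> q \<in> G \<and> p \<noteq> q \<and> ?f p = ?f q}"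
    by (rule card_le_card_image_plus_collisions[OF fin(2)])
  also have "card (?f ` G) \<le> card (ordered_overlapping_pairs N dl M dr w)"
  proof (rule card_mono)
    show "?f ` G \<subseteq> ordered_overlapping_pairs N dl M dr w"
      unfolding ordered_overlapping_pairs_eq_image[OF w]
      by (rule image_mono) (use GS ST in \<open>auto simp: G_def\<close>)
  qed simp
  \<comment> \<open>Two colliding pairs of \<open>G\<close> have their first half-edges colocated,
    and likewise their second ones; that the communities are small is part of
    \<open>G\<close>.\<close>
  also have "card {(p, q). p \<in> G \<and> q \<in> G \<and> p \<noteq> q \<and> ?f p = ?f q} \<le> card (?C1 \<union> ?C2)"
  proof (rule card_mono)
    show "finite (?C1 \<union> ?C2)"
      by (rule finite_subset[of _ "S \<times> S"]) (use fin in auto)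
    show "{(p, q). p \<in> G \<and> q \<in> G \<and> p \<noteq> q \<and> ?f p = ?f q} \<subseteq> ?C1 \<union> ?C2"
    proof (rule subrelI)
      fix p q assume "(p, q) \<in> {(p, q). p \<in> G \<and> q \<in> G \<and> p \<noteq> q \<and> ?f p = ?f q}"
      then have pq: "p \<in> G" "q \<in> G" "p \<noteq> q" and f: "fst (w (fst p)) = fst (w (fst q))"
        "fst (w (snd p)) = fst (w (snd q))" by auto
      have S: "p \<in> S" "q \<in> S" using pq GS by auto
      then have "(w (fst p), w (fst q)) \<in> C" "(w (snd p), w (snd q)) \<in> C"
        using wR[of p] wR[of q] ST f pq by (auto simp: C_def colocated_roles_def G_def)
      then show "(p, q) \<in> ?C1 \<union> ?C2" using S pq by simp
    qed
  qed
  also have "card (?C1 \<union> ?C2) \<le> card ?C1 + card ?C2" by (rule card_Un_le)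
  finally show ?thesis by (simp add: algebra_simps)
qed

text \<open>Given \<open>p\<close>, both half-edges of \<open>q\<close> belong to the same
  individual, whose degree is at most \<open>K\<close>, so there are at most
  \<open>K\<^sup>2\<close> choices of \<open>q\<close>.\<close>

lemma card_same_individual_pairs:
  "card {(p, q). p \<in> small_sibling_pairs K N dl \<and> q \<in> small_sibling_pairs K N dl
      \<and> p \<noteq> q \<and> fst (fst p) = fst (fst q)} \<le> card (half_edges N dl) * K * K\<^sup>2"
proof -
  let ?S = "small_sibling_pairs K N dl"
  let ?V = "\<lambda>p. ({fst (fst p)} \<times> {1..dl (fst (fst p))}) \<times> ({fst (fst p)} \<times> {1..dl (fst (fst p))})"
  have "{(p, q). p \<in> ?S \<and> q \<in> ?S \<and> p \<noteq> q \<and> fst (fst p) = fst (fst q)} \<subseteq> (SIGMA p:?S. ?V p)"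
    by (auto simp: small_sibling_pairs_def sibling_pairs_def half_edges_def)
  then have "card {(p, q). p \<in> ?S \<and> q \<in> ?S \<and> p \<noteq> q \<and> fst (fst p) = fst (fst q)}
      \<le> card (SIGMA p:?S. ?V p)"
    by (rule card_mono[rotated]) auto
  also have "\<dots> = (\<Sum>p\<in>?S. dl (fst (fst p)) * dl (fst (fst p)))"
    by (subst card_SigmaI) (auto simp: card_cartesian_product)
  also have "\<dots> \<le> (\<Sum>p\<in>?S. K\<^sup>2)"
    unfolding power2_eq_square
    by (intro sum_mono mult_mono) (auto simp: small_sibling_pairs_def)
  also have "\<dots> = card ?S * K\<^sup>2" by simp
  also have "\<dots> \<le> card (half_edges N dl) * K * K\<^sup>2"
    by (rule mult_right_mono[OF card_sibling_pairs_small]) simp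
  finally show ?thesis .
qed

section \<open>Expected loss under a uniform matching\<close>

context
  fixes N M :: nat and dl dr :: "nat \<Rightarrow> nat" and K :: nat
  assumes degree_sum: "(\<Sum>v=1..N. dl v) = (\<Sum>a=1..M. dr a)"
begin

private abbreviation (input) "W \<equiv> matchings N dl M dr"
private abbreviation (input) "h \<equiv> card (half_edges N dl)"
private abbreviation (input) "C \<equiv> colocated_roles K M dr"

lemma card_roles: "card (half_edges M dr) = h"
  using degree_sum by (simp add: card_half_edges)

lemma finite_matchings: "finite W"
  by (simp add: matchings_eq_bijections)

lemma card_matchings: "card W = fact h"
  by (simp add: matchings_eq_bijections card_bijections card_roles)

lemma card_matchings_map_in:
  assumes "distinct xs" "set xs \<subseteq> half_edges N dl" "finite S"
  shows "card {w \<in> W. map w xs \<in> S} \<le> card S * fact (h - length xs)"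
  unfolding matchings_eq_bijections
  by (rule card_bijections_map_in) (use assms card_roles in auto)

text \<open>First-moment bound by exchanging sums: the number of configurations times the number of
  matchings that realise one of them.\<close>

lemma sum_card_le:
  assumes "finite T" "\<And>t. t \<in> T \<Longrightarrow> card {w \<in> W. Q w t} \<le> c" "card T \<le> k"
  shows "(\<Sum>w\<in>W. card {t \<in> T. Q w t}) \<le> k * c"
proof -
  have "(\<Sum>w\<in>W. card {t \<in> T. Q w t}) = (\<Sum>t\<in>T. card {w \<in> W. Q w t})"
    by (rule sum_card_swap[OF finite_matchings assms(1)])
  also have "\<dots> \<le> (\<Sum>t\<in>T. c)" by (rule sum_mono) (rule assms(2))
  also have "\<dots> \<le> k * c" using assms(3) by simp
  finally show ?thesis .
qed

text \<open>The role taken by \<open>x\<close> is uniform, so its community is size-biased: divided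
  by \<open>fact h\<close>, the bound is the share of roles lying in large communities.\<close>

lemma card_large_community:
  assumes x: "x \<in> half_edges N dl"
  shows "card {w \<in> W. dr (fst (w x)) > K} \<le> (\<Sum>a | a \<in> {1..M} \<and> dr a > K. dr a) * fact (h - 1)"
proof -
  let ?B = "{r \<in> half_edges M dr. dr (fst r) > K}"
  have "{w \<in> W. dr (fst (w x)) > K} = {w \<in> W. map w [x] \<in> (\<lambda>r. [r]) ` ?B}"
    using matching_maps_to[OF _ x] by (fastforce simp: image_iff)
  also have "card \<dots> \<le> card ((\<lambda>r. [r]) ` ?B) * fact (h - length [x])"
    by (rule card_matchings_map_in) (use x in auto)
  also have "\<dots> \<le> card ?B * fact (h - 1)"
    using card_image_le[of ?B "\<lambda>r. [r]"] by simp
  finally show ?thesis by (simp add: card_half_edges_filter[of M dr "\<lambda>a. dr a > K"])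
qed

lemma card_colocated_le: "card C \<le> h * K"
  using card_colocated_roles[of K M dr] card_roles by simp

text \<open>Relative to \<open>fact h\<close> this is of order \<open>K / h\<close>: at most
  \<open>h * K\<close> colocated role pairs, each prescribing two images.\<close>

lemma card_colocated:
  assumes "x \<in> half_edges N dl" "y \<in> half_edges N dl" "x \<noteq> y"
  shows "card {w \<in> W. (w x, w y) \<in> C} \<le> h * K * fact (h - 2)"
proof -
  have iff: "[r, s] \<in> (\<lambda>(r, s). [r, s]) ` C \<longleftrightarrow> (r, s) \<in> C" for r s by force
  have "{w \<in> W. (w x, w y) \<in> C} = {w \<in> W. map w [x, y] \<in> (\<lambda>(r, s). [r, s]) ` C}"
    by (simp add: iff)
  also have "card \<dots> \<le> card ((\<lambda>(r, s). [r, s]) ` C) * fact (h - length [x, y])"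
    by (rule card_matchings_map_in) (use assms in auto)
  also have "\<dots> \<le> card C * fact (h - 2)"
    using card_image_le[of C "\<lambda>(r, s). [r, s]"] by (simp add: eval_nat_numeral)
  also have "\<dots> \<le> h * K * fact (h - 2)" using card_colocated_le by simp
  finally show ?thesis .
qed

text \<open>Two disjoint colocations have probability of order K^2 / h^2, which balances the at most
  (h K)^2 pairs of small sibling pairs at different individuals.\<close>

lemma card_colocated_twice:
  assumes "set [x, y, x', y'] \<subseteq> half_edges N dl" "distinct [x, y, x', y']"
  shows "card {w \<in> W. (w x, w y) \<in> C \<and> (w x', w y') \<in> C} \<le> (h * K)\<^sup>2 * fact (h - 4)"
proof -
  let ?g = "\<lambda>((r, s), (r', s')). [r, s, r', s']"
  have iff: "[r, s, r', s'] \<in> ?g ` (C \<times> C) \<longleftrightarrow> (r, s) \<in> C \<and> (r', s') \<in> C" for r s r' s'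
    by force
  have "{w \<in> W. (w x, w y) \<in> C \<and> (w x', w y') \<in> C}
      = {w \<in> W. map w [x, y, x', y'] \<in> ?g ` (C \<times> C)}"
    by (simp add: iff)
  also have "card \<dots> \<le> card (?g ` (C \<times> C)) * fact (h - length [x, y, x', y'])"
    by (rule card_matchings_map_in) (use assms in auto)
  also have "\<dots> \<le> card (C \<times> C) * fact (h - 4)"
    using card_image_le[of "C \<times> C" ?g] by (simp add: eval_nat_numeral card_cartesian_product)
  also have "card (C \<times> C) \<le> (h * K)\<^sup>2"
    unfolding card_cartesian_product power2_eq_square by (intro mult_mono card_colocated_le) auto
  finally show ?thesis by simp
qed

text \<open>Divided by \<open>fact h\<close>, this bounds the expected deficit. Each loss
  contributes its number of configurations times a probability: small pairs inside one community
  give 2 K^2, collisions at one individual 2 K^4, collisions between two individuals 8 K^4. The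
  factors 2 and 8 come from the factorial ratios.\<close>

lemma sum_card_sibling_pairs_minus_overlapping_le:
  assumes h: "h \<ge> 6"
  shows "(\<Sum>w\<in>W. real (card (sibling_pairs N dl)) - real (card (ordered_overlapping_pairs N dl M dr w)))
    \<le> fact h * ((\<Sum>v | v \<in> {1..N} \<and> dl v > K. (real (dl v))\<^sup>2)
        + 2 * real (card (sibling_pairs N dl)) * (\<Sum>a | a \<in> {1..M} \<and> dr a > K. real (dr a)) / h
        + 2 * real K ^ 2 + 10 * real K ^ 4)"
proof -
  let ?T = "sibling_pairs N dl" and ?S = "small_sibling_pairs K N dl"
  let ?P1 = "{(p, q). p \<in> ?S \<and> q \<in> ?S \<and> p \<noteq> q \<and> fst (fst p) = fst (fst q)}"
  let ?P2 = "{(p, q). p \<in> ?S \<and> q \<in> ?S \<and> fst (fst p) \<noteq> fst (fst q)}"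
  let ?coll = "\<lambda>w z. (w (fst (fst z)), w (fst (snd z))) \<in> C \<and> (w (snd (fst z)), w (snd (snd z))) \<in> C"
  let ?R = "\<Sum>a | a \<in> {1..M} \<and> dr a > K. dr a"
  have finP: "finite ?P1" "finite ?P2"
    by (rule finite_subset[of _ "?S \<times> ?S"]; auto)+
  have inL: "fst p \<in> half_edges N dl" "snd p \<in> half_edges N dl" "fst p \<noteq> snd p"
      "fst (snd p) = fst (fst p)" if "p \<in> ?T" for p
    using that by (auto simp: sibling_pairs_def)
  have ST: "p \<in> ?T" if "p \<in> ?S" for p using that by (simp add: small_sibling_pairs_def)
  have card_S: "card ?S \<le> h * K"
    by (rule card_sibling_pairs_small)
  have a: "card {p \<in> ?T. dl (fst (fst p)) > K} \<le> (\<Sum>v | v \<in> {1..N} \<and> dl v > K. (dl v)\<^sup>2)"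
    unfolding card_sibling_pairs_filter[of N dl "\<lambda>v. dl v > K"] power2_eq_square
    by (intro sum_mono mult_left_mono) auto
  have b1: "(\<Sum>w\<in>W. card {p \<in> ?T. dr (fst (w (fst p))) > K}) \<le> card ?T * (?R * fact (h - 1))"
    by (rule sum_card_le[OF _ card_large_community]) (use inL in auto)
  have b2: "(\<Sum>w\<in>W. card {p \<in> ?T. dr (fst (w (snd p))) > K}) \<le> card ?T * (?R * fact (h - 1))"
    by (rule sum_card_le[OF _ card_large_community]) (use inL in auto)
  have c: "(\<Sum>w\<in>W. card {p \<in> ?S. (w (fst p), w (snd p)) \<in> C}) \<le> h * K * (h * K * fact (h - 2))"
    by (rule sum_card_le[OF _ card_colocated card_S]) (auto dest!: ST dest: inL)
  \<comment> \<open>The four half-edges may partly coincide here, for instance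
    \<open>x' = y\<close>, so only one colocation is used. It suffices, since the number of such
    pairs of pairs is at most linear in \<open>h\<close>.\<close>
  have d: "(\<Sum>w\<in>W. card {z \<in> ?P1. ?coll w z}) \<le> h * K * K\<^sup>2 * (h * K * fact (h - 2))"
  proof (rule sum_card_le[OF finP(1) _ card_same_individual_pairs])
    fix z assume z: "z \<in> ?P1"
    obtain x y x' y' where z_eq: "z = ((x, y), (x', y'))" by (metis surj_pair)
    have L: "x \<in> half_edges N dl" "y \<in> half_edges N dl" "x' \<in> half_edges N dl" "y' \<in> half_edges N dl"
      and "x \<noteq> x' \<or> y \<noteq> y'"
      using z z_eq inL[of "(x, y)"] inL[of "(x', y')"] ST by auto
    then show "card {w \<in> W. ?coll w z} \<le> h * K * fact (h - 2)"
    proof (elim disjE)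
      assume "x \<noteq> x'"
      have "card {w \<in> W. ?coll w z} \<le> card {w \<in> W. (w x, w x') \<in> C}"
        by (rule card_mono) (use z_eq finite_matchings in auto)
      also have "\<dots> \<le> h * K * fact (h - 2)"
        by (rule card_colocated) (use L \<open>x \<noteq> x'\<close> in auto)
      finally show ?thesis .
    next
      assume "y \<noteq> y'"
      have "card {w \<in> W. ?coll w z} \<le> card {w \<in> W. (w y, w y') \<in> C}"
        by (rule card_mono) (use z_eq finite_matchings in auto)
      also have "\<dots> \<le> h * K * fact (h - 2)"
        by (rule card_colocated) (use L \<open>y \<noteq> y'\<close> in auto)
      finally show ?thesis .
    qed
  qed
  \<comment> \<open>Different individuals make all four half-edges distinct, so both colocations
    count and cancel the factor h^2 from the number of configurations.\<close>
  have e: "(\<Sum>w\<in>W. card {z \<in> ?P2. ?coll w z}) \<le> (h * K)\<^sup>2 * ((h * K)\<^sup>2 * fact (h - 4))"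
  proof (rule sum_card_le[OF finP(2)])
    fix z assume z: "z \<in> ?P2"
    obtain x y x' y' where z_eq: "z = ((x, y), (x', y'))" by (metis surj_pair)
    have "set [x, x', y, y'] \<subseteq> half_edges N dl" "distinct [x, x', y, y']"
      using z z_eq inL[of "(x, y)"] inL[of "(x', y')"] ST by auto
    from card_colocated_twice[OF this] show "card {w \<in> W. ?coll w z} \<le> (h * K)\<^sup>2 * fact (h - 4)"
      by (simp add: z_eq)
  next
    have "card ?P2 \<le> card (?S \<times> ?S)" by (rule card_mono) auto
    also have "\<dots> \<le> (h * K)\<^sup>2"
      unfolding card_cartesian_product power2_eq_square by (intro mult_mono card_S) auto
    finally show "card ?P2 \<le> (h * K)\<^sup>2" .
  qed
  let ?A = "\<Sum>v | v \<in> {1..N} \<and> dl v > K. (dl v)\<^sup>2"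
  have "(\<Sum>w\<in>W. real (card ?T) - real (card (ordered_overlapping_pairs N dl M dr w)))
      \<le> (\<Sum>w\<in>W. real (?A
          + card {p \<in> ?T. dr (fst (w (fst p))) > K} + card {p \<in> ?T. dr (fst (w (snd p))) > K}
          + card {p \<in> ?S. (w (fst p), w (snd p)) \<in> C}
          + card {z \<in> ?P1. ?coll w z} + card {z \<in> ?P2. ?coll w z}))"
  proof (rule sum_mono)
    fix w assume w: "w \<in> W"
    show "real (card ?T) - real (card (ordered_overlapping_pairs N dl M dr w)) \<le> real (?A
          + card {p \<in> ?T. dr (fst (w (fst p))) > K} + card {p \<in> ?T. dr (fst (w (snd p))) > K}
          + card {p \<in> ?S. (w (fst p), w (snd p)) \<in> C}
          + card {z \<in> ?P1. ?coll w z} + card {z \<in> ?P2. ?coll w z})"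
      using card_sibling_pairs_le[OF w, of K] a by linarith
  qed
  also have "\<dots> = real (card W * ?A
        + (\<Sum>w\<in>W. card {p \<in> ?T. dr (fst (w (fst p))) > K})
        + (\<Sum>w\<in>W. card {p \<in> ?T. dr (fst (w (snd p))) > K})
        + (\<Sum>w\<in>W. card {p \<in> ?S. (w (fst p), w (snd p)) \<in> C})
        + (\<Sum>w\<in>W. card {z \<in> ?P1. ?coll w z}) + (\<Sum>w\<in>W. card {z \<in> ?P2. ?coll w z}))"
    unfolding of_nat_sum[symmetric] sum.distrib by simp
  also have "\<dots> \<le> real (fact h * ?A + card ?T * (?R * fact (h - 1)) + card ?T * (?R * fact (h - 1))
        + h * K * (h * K * fact (h - 2)) + h * K * K\<^sup>2 * (h * K * fact (h - 2))
        + (h * K)\<^sup>2 * ((h * K)\<^sup>2 * fact (h - 4)))"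
    unfolding of_nat_le_iff card_matchings by (intro add_mono b1 b2 c d e order_refl)
  also have "h * K * (h * K * fact (h - 2)) = K\<^sup>2 * (h\<^sup>2 * fact (h - 2))"
    by (simp add: power2_eq_square)
  also have "h * K * K\<^sup>2 * (h * K * fact (h - 2)) = K ^ 4 * (h\<^sup>2 * fact (h - 2))"
    by (simp add: power2_eq_square power4_eq_xxxx)
  also have "(h * K)\<^sup>2 * ((h * K)\<^sup>2 * fact (h - 4)) = K ^ 4 * (h ^ 4 * fact (h - 4))"
    by (simp add: power2_eq_square power4_eq_xxxx)
  also have "real (fact h * ?A + card ?T * (?R * fact (h - 1)) + card ?T * (?R * fact (h - 1))
        + K\<^sup>2 * (h\<^sup>2 * fact (h - 2)) + K ^ 4 * (h\<^sup>2 * fact (h - 2)) + K ^ 4 * (h ^ 4 * fact (h - 4)))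
      \<le> real (fact h * ?A + card ?T * (?R * fact (h - 1)) + card ?T * (?R * fact (h - 1))
        + K\<^sup>2 * (2 * fact h) + K ^ 4 * (2 * fact h) + K ^ 4 * (8 * fact h))"
    unfolding of_nat_le_iff
    by (intro add_mono mult_left_mono order_refl square_times_fact_le[OF h]
        power4_times_fact_le[OF h]) auto
  also have "\<dots> = fact h * (real ?A + 2 * real (card ?T) * real ?R / h
        + 2 * real K ^ 2 + 10 * real K ^ 4)"
  proof -
    have "(fact h :: real) = real h * fact (h - 1)" using h by (simp add: fact_reduce)
    moreover have "real h \<noteq> 0" using h by linarith
    ultimately have "(fact (h - 1) :: real) = fact h / h" by (metis nonzero_mult_div_cancel_left)
    then show ?thesis by (simp add: algebra_simps)
  qed
  finally show ?thesis by simp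
qed

end

section \<open>Uniform integrability of the degrees\<close>

text \<open>Half-integers carry no mass, hence are continuity points of the limiting distribution
  function, and the mass at \<open>k\<close> is its increment from k - 1/2 to k + 1/2.\<close>

lemma conv_in_distribution_imp_pmf:
  assumes "conv_in_distribution p q"
  shows "(\<lambda>n. pmf (p n) k) \<longlonglongrightarrow> pmf q k"
proof -
  let ?F = "\<lambda>r x. cdf (distr (measure_pmf r) borel real) x"
  have F: "?F r x = measure_pmf.prob r {j. real j \<le> x}" for r x
    unfolding cdf_def by (subst measure_distr) (auto simp: vimage_def)
  have lim: "(\<lambda>n. ?F (p n) x) \<longlonglongrightarrow> ?F q x" if "\<And>j. x \<noteq> real j" for x
  proof -
    interpret d: real_distribution "distr (measure_pmf q) borel real"
      by (rule prob_space.real_distribution_distr[OF prob_space_measure_pmf]) simp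
    have "real -` {x} = {}" using that by (auto simp: vimage_def)
    then have "measure (distr (measure_pmf q) borel real) {x} = 0"
      by (subst measure_distr) auto
    then have "isCont (?F q) x" by (simp add: d.isCont_cdf)
    then show ?thesis
      using assms by (auto simp: conv_in_distribution_def weak_conv_m_def weak_conv_def)
  qed
  have pmf: "pmf r k = ?F r (k + 1/2) - ?F r (k - 1/2)" for r
  proof -
    have "{j. real j \<le> k + 1/2} = {..k}" and "{j. real j \<le> k - 1/2} = {..<k}"
      by auto
    moreover have "measure_pmf.prob r {..k} = measure_pmf.prob r {..<k} + pmf r k"
      by (simp add: measure_measure_pmf_finite flip: lessThan_Suc_atMost)
    ultimately show ?thesis by (simp add: F)
  qed
  have "real k + 1/2 \<noteq> real j \<and> real k - 1/2 \<noteq> real j" for j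
    by (cases j k rule: linorder_cases) auto
  then show ?thesis unfolding pmf by (intro tendsto_diff lim) auto
qed

lemma expectation_tail_eq:
  fixes g :: "nat \<Rightarrow> real"
  assumes "integrable (measure_pmf q) g"
  shows "measure_pmf.expectation q (\<lambda>k. g k * indicator {K<..} k)
    = measure_pmf.expectation q g - (\<Sum>k\<le>K. g k * pmf q k)"
proof -
  have fin: "integrable (measure_pmf q) (\<lambda>k. g k * indicator {..K} k)"
    by (rule Bochner_Integration.integrable_bound[OF assms]) (auto simp: indicator_def)
  have "measure_pmf.expectation q (\<lambda>k. g k * indicator {K<..} k)
      = measure_pmf.expectation q (\<lambda>k. g k - g k * indicator {..K} k)"
    by (intro Bochner_Integration.integral_cong) (auto simp: indicator_def)
  also have "\<dots> = measure_pmf.expectation q g - measure_pmf.expectation q (\<lambda>k. g k * indicator {..K} k)"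
    by (rule Bochner_Integration.integral_diff[OF assms fin])
  also have "measure_pmf.expectation q (\<lambda>k. g k * indicator {..K} k)
      = (\<Sum>k\<le>K. (g k * indicator {..K} k) * pmf q k)"
    by (rule integral_measure_pmf_real) (auto simp: indicator_def split: if_splits)
  also have "\<dots> = (\<Sum>k\<le>K. g k * pmf q k)" by (rule sum.cong) auto
  finally show ?thesis .
qed

text \<open>The head is a finite sum and converges termwise. Convergence of the full expectation
  then forces that of the tail, so no mass escapes to infinity.\<close>

lemma expectation_tail_tendsto:
  fixes g :: "nat \<Rightarrow> real"
  assumes "\<And>k. (\<lambda>n. pmf (p n) k) \<longlonglongrightarrow> pmf q k"
    and "\<And>n. integrable (measure_pmf (p n)) g" "integrable (measure_pmf q) g"
    and "(\<lambda>n. measure_pmf.expectation (p n) g) \<longlonglongrightarrow> measure_pmf.expectation q g"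
  shows "(\<lambda>n. measure_pmf.expectation (p n) (\<lambda>k. g k * indicator {K<..} k))
    \<longlonglongrightarrow> measure_pmf.expectation q (\<lambda>k. g k * indicator {K<..} k)"
  unfolding expectation_tail_eq[OF assms(2)] expectation_tail_eq[OF assms(3)]
  by (intro tendsto_intros assms)

text \<open>Dominated convergence: at each \<open>k\<close> the integrand vanishes once
  \<open>K\<close> reaches \<open>k\<close>.\<close>

lemma expectation_tail_tendsto_0:
  fixes g :: "nat \<Rightarrow> real"
  assumes "integrable (measure_pmf q) g"
  shows "(\<lambda>K. measure_pmf.expectation q (\<lambda>k. g k * indicator {K<..} k)) \<longlonglongrightarrow> 0"
proof -
  have "(\<lambda>K. measure_pmf.expectation q (\<lambda>k. g k * indicator {K<..} k))
      \<longlonglongrightarrow> measure_pmf.expectation q (\<lambda>k. 0)"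
  proof (rule integral_dominated_convergence[where w = "\<lambda>k. norm (g k)"])
    show "AE k in measure_pmf q. (\<lambda>K. g k * indicator {K<..} k) \<longlonglongrightarrow> 0"
    proof (rule AE_I2)
      fix k
      have "\<forall>\<^sub>F K in sequentially. g k * indicator {K<..} k = 0"
        using eventually_ge_at_top[of k] by eventually_elim auto
      then show "(\<lambda>K. g k * indicator {K<..} k) \<longlonglongrightarrow> 0" by (rule tendsto_eventually)
    qed
  qed (use assms in \<open>auto simp: indicator_def\<close>)
  then show ?thesis by simp
qed

section \<open>Degree laws as empirical averages\<close>

lemma expectation_degree_law:
  fixes g :: "nat \<Rightarrow> real"
  assumes "K \<ge> 1"
  shows "measure_pmf.expectation (degree_law K d) g = (\<Sum>v=1..K. g (d v)) / K"
  using assms by (simp add: degree_law_def integral_pmf_of_set)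

lemma integrable_degree_law:
  fixes g :: "nat \<Rightarrow> real"
  assumes "K \<ge> 1"
  shows "integrable (measure_pmf (degree_law K d)) g"
  by (rule integrable_measure_pmf_finite) (use assms in \<open>simp add: degree_law_def\<close>)

lemma expectation_degree_law_tail:
  fixes g :: "nat \<Rightarrow> real"
  assumes "N \<ge> 1"
  shows "measure_pmf.expectation (degree_law N d) (\<lambda>k. g k * indicator {K<..} k)
    = (\<Sum>v | v \<in> {1..N} \<and> d v > K. g (d v)) / N"
proof -
  have "(\<Sum>v | v \<in> {1..N} \<and> d v > K. g (d v)) = (\<Sum>v=1..N. if d v > K then g (d v) else 0)"
    by (rule sum.inter_filter) simp
  also have "\<dots> = (\<Sum>v=1..N. g (d v) * indicator {K<..} (d v))"
    by (rule sum.cong) auto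
  finally show ?thesis by (simp only: expectation_degree_law[OF assms])
qed

lemma pmf_degree_law:
  assumes "N \<ge> 1"
  shows "pmf (degree_law N d) k = card {v \<in> {1..N}. d v = k} / N"
proof -
  have "pmf (degree_law N d) k = measure_pmf.prob (pmf_of_set {1..N}) {v. d v = k}"
    by (simp add: degree_law_def pmf_map vimage_def)
  also have "\<dots> = card ({1..N} \<inter> {v. d v = k}) / card {1..N}"
    by (rule measure_pmf_of_set) (use assms in auto)
  finally show ?thesis by (simp add: Int_def)
qed

text \<open>Writing expectations as series makes the index shift of size biasing available; for a
  non-negative \<open>f\<close>, summability is already absolute.\<close>

lemma integrable_nat_pmf_iff:
  fixes f :: "nat \<Rightarrow> real"
  assumes "\<And>k. f k \<ge> 0"
  shows "integrable (measure_pmf p) f \<longleftrightarrow> summable (\<lambda>k. pmf p k * f k)"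
proof -
  have "integrable (measure_pmf p) f \<longleftrightarrow> integrable (count_space UNIV) (\<lambda>k. pmf p k *\<^sub>R f k)"
    unfolding measure_pmf_eq_density by (rule integrable_density) auto
  also have "\<dots> \<longleftrightarrow> summable (\<lambda>k. pmf p k * f k)"
    using assms by (simp add: integrable_count_space_nat_iff abs_mult)
  finally show ?thesis .
qed

lemma expectation_nat_pmf:
  fixes f :: "nat \<Rightarrow> real"
  assumes "\<And>k. f k \<ge> 0" "summable (\<lambda>k. pmf p k * f k)"
  shows "measure_pmf.expectation p f = (\<Sum>k. pmf p k * f k)"
proof -
  have "measure_pmf.expectation p f = (\<integral>k. pmf p k *\<^sub>R f k \<partial>count_space UNIV)"
    unfolding measure_pmf_eq_density by (rule integral_density) auto
  also have "\<dots> = (\<Sum>k. pmf p k * f k)"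
    by (subst integral_count_space_nat)
      (use assms in \<open>auto simp: integrable_count_space_nat_iff abs_mult\<close>)
  finally show ?thesis .
qed

text \<open>With j = k + 1 the weight k (k + 1) becomes j^2 - j, and the term j = 0 lost by the
  shift is zero. The mean is therefore a factorial moment of \<open>p\<close> divided by
  \<open>c\<close>.\<close>

lemma expectation_size_biased:
  fixes p p' :: "nat pmf"
  assumes "integrable (measure_pmf p) (\<lambda>k. (real k)\<^sup>2)"
    and p': "\<And>k. pmf p' k = (real k + 1) * pmf p (k + 1) / c"
  shows "measure_pmf.expectation p' real = measure_pmf.expectation p (\<lambda>k. (real k)\<^sup>2 - real k) / c"
proof -
  let ?f = "\<lambda>k. (real k)\<^sup>2 - real k"
  have f_nonneg: "?f k \<ge> 0" for k
    by (cases k) (auto simp: power2_eq_square algebra_simps)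
  have "integrable (measure_pmf p) ?f"
    by (rule Bochner_Integration.integrable_bound[OF assms(1)]) (use f_nonneg in auto)
  then have sm: "summable (\<lambda>k. pmf p k * ?f k)"
    unfolding integrable_nat_pmf_iff[OF f_nonneg] .
  have shift: "pmf p' k * real k = (pmf p (Suc k) * ?f (Suc k)) / c" for k
    by (simp add: p' power2_eq_square algebra_simps)
  have sm': "summable (\<lambda>k. pmf p (Suc k) * ?f (Suc k))"
    by (subst summable_Suc_iff) (rule sm)
  have "measure_pmf.expectation p' real = (\<Sum>k. pmf p' k * real k)"
    by (rule expectation_nat_pmf) (simp, unfold shift, rule summable_divide[OF sm'])
  also have "\<dots> = (\<Sum>k. pmf p (Suc k) * ?f (Suc k)) / c"
    unfolding shift by (rule suminf_divide[OF sm'])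
  also have "(\<Sum>k. pmf p (Suc k) * ?f (Suc k)) = (\<Sum>k. pmf p k * ?f k)"
    using suminf_split_head[OF sm] by simp
  also have "\<dots> = measure_pmf.expectation p ?f"
    by (rule expectation_nat_pmf[OF f_nonneg sm, symmetric])
  finally show ?thesis .
qed

section \<open>Conditioning on the matching\<close>

text \<open>\<open>X\<close> and \<open>Y\<close> take finitely many values, so all functions
  involved are finite combinations of indicators of the atoms \<open>?A s \<inter> ?B t\<close>.
  Independence and uniformity of \<open>Y\<close> give each atom probability
  \<open>prob (?A s) / card T\<close>, and so the average over \<open>t\<close> satisfies the
  defining integral identity.\<close>

lemma AE_cond_exp_given_independent_uniform:
  fixes P :: "'a measure" and X :: "'a \<Rightarrow> 'b" and Y :: "'a \<Rightarrow> 'c" and f :: "'b \<Rightarrow> 'c \<Rightarrow> real"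
  assumes "prob_space P" and S: "finite S" and T: "finite T"
    and X: "X \<in> measurable P (count_space S)"
    and Y: "Y \<in> measurable P (count_space T)"
    and unif: "distr P (count_space T) Y = uniform_count_measure T"
    and indep: "indep_elements P (count_space S) X (count_space T) Y"
  shows "AE x in P. cond_exp_given P (count_space S) X (\<lambda>y. f (X y) (Y y)) x
    = (\<Sum>t\<in>T. f (X x) t) / card T"
proof -
  interpret prob_space P by fact
  let ?F = "vimage_algebra (space P) X (count_space S)"
  let ?A = "\<lambda>s. X -` {s} \<inter> space P" and ?B = "\<lambda>t. Y -` {t} \<inter> space P"
  let ?g = "\<lambda>s. (\<Sum>t\<in>T. f s t) / card T"
  have XS: "X x \<in> S" and YT: "Y x \<in> T" if "x \<in> space P" for x
    using that measurable_space[OF X] measurable_space[OF Y] by auto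
  have sets_F: "sets ?F = {X -` U \<inter> space P | U. U \<in> sets (count_space S)}"
    by (rule sets_vimage_algebra2) (use XS in auto)
  have "subalgebra P ?F"
    unfolding subalgebra_def sets_F using measurable_sets[OF X] by auto
  then interpret finite_measure_subalgebra P ?F
    by unfold_locales
  have A: "?A s \<in> sets P" if "s \<in> S" for s
    using that by (intro measurable_sets[OF X]) auto
  have B: "?B t \<in> sets P" if "t \<in> T" for t
    using that by (intro measurable_sets[OF Y]) auto
  have prob_AB: "prob (?A s \<inter> ?B t) = prob (?A s) / card T" if "s \<in> S" "t \<in> T" for s t
  proof -
    have "prob (?A s \<inter> ?B t) = prob (?A s) * prob (?B t)"
    proof (rule indep_setD)
      show "indep_set (sets ?F) (sets (vimage_algebra (space P) Y (count_space T)))"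
        using indep by (simp add: indep_elements_def)
      show "?A s \<in> sets ?F" "?B t \<in> sets (vimage_algebra (space P) Y (count_space T))"
        using that by (auto intro!: in_vimage_algebra)
    qed
    also have "prob (?B t) = measure (distr P (count_space T) Y) {t}"
      by (rule measure_distr[symmetric, OF Y]) (use that in auto)
    also have "\<dots> = 1 / card T"
      unfolding unif using T that by (subst measure_uniform_count_measure) auto
    finally show ?thesis by simp
  qed
  have ind: "indicator (?A s \<inter> ?B t) x = (if s = X x then if t = Y x then 1 else 0 else (0::real))"
    "indicator (?A s) x = (if s = X x then 1 else (0::real))" if "x \<in> space P" for x s t
    using that by (auto simp: indicator_def)
  \<comment> \<open>The coefficients stay arbitrary because the formulas serve both for
    \<open>f\<close> and for \<open>f\<close> cut off to an event in \<open>?F\<close>.\<close>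
  have intf: "integrable P (\<lambda>x. \<Sum>s\<in>S. \<Sum>t\<in>T. c s t * indicator (?A s \<inter> ?B t) x)"
    and valf: "(\<integral>x. (\<Sum>s\<in>S. \<Sum>t\<in>T. c s t * indicator (?A s \<inter> ?B t) x) \<partial>P)
      = (\<Sum>s\<in>S. \<Sum>t\<in>T. c s t * prob (?A s \<inter> ?B t))" for c :: "'b \<Rightarrow> 'c \<Rightarrow> real"
  proof -
    have i: "integrable P (\<lambda>x. c s t * indicator (?A s \<inter> ?B t) x)" if "s \<in> S" "t \<in> T" for s t
      using A B that by (intro integrable_mult_right) (auto simp: less_top[symmetric])
    then show "integrable P (\<lambda>x. \<Sum>s\<in>S. \<Sum>t\<in>T. c s t * indicator (?A s \<inter> ?B t) x)"
      by (intro Bochner_Integration.integrable_sum) auto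
    show "(\<integral>x. (\<Sum>s\<in>S. \<Sum>t\<in>T. c s t * indicator (?A s \<inter> ?B t) x) \<partial>P)
      = (\<Sum>s\<in>S. \<Sum>t\<in>T. c s t * prob (?A s \<inter> ?B t))"
      using A B i
      by (subst Bochner_Integration.integral_sum, force, intro sum.cong refl,
          subst Bochner_Integration.integral_sum, force, intro sum.cong refl) simp
  qed
  have intg: "integrable P (\<lambda>x. \<Sum>s\<in>S. c s * indicator (?A s) x)"
    and valg: "(\<integral>x. (\<Sum>s\<in>S. c s * indicator (?A s) x) \<partial>P) = (\<Sum>s\<in>S. c s * prob (?A s))"
    for c :: "'b \<Rightarrow> real"
  proof -
    have i: "integrable P (\<lambda>x. c s * indicator (?A s) x)" if "s \<in> S" for s
      using A that by (intro integrable_mult_right) (auto simp: less_top[symmetric])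
    then show "integrable P (\<lambda>x. \<Sum>s\<in>S. c s * indicator (?A s) x)"
      by (intro Bochner_Integration.integrable_sum) auto
    show "(\<integral>x. (\<Sum>s\<in>S. c s * indicator (?A s) x) \<partial>P) = (\<Sum>s\<in>S. c s * prob (?A s))"
      using A i by (subst Bochner_Integration.integral_sum, force, intro sum.cong refl) simp
  qed
  \<comment> \<open>Only the atom containing \<open>x\<close> contributes, so the combination of
    indicators is the function itself.\<close>
  have sum_f: "(\<Sum>s\<in>S. \<Sum>t\<in>T. c s t * indicator (?A s \<inter> ?B t) x) = c (X x) (Y x)"
    if "x \<in> space P" for c :: "'b \<Rightarrow> 'c \<Rightarrow> real" and x
  proof -
    have "(\<Sum>t\<in>T. c s t * indicator (?A s \<inter> ?B t) x) = (if s = X x then c s (Y x) else 0)" for s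
      unfolding ind[OF that] using T YT[OF that]
      by (cases "s = X x") (simp_all add: if_distrib[of "(*) _"] sum.delta cong: if_cong)
    then show ?thesis using S XS[OF that] by (simp add: sum.delta)
  qed
  have sum_g: "(\<Sum>s\<in>S. c s * indicator (?A s) x) = c (X x)"
    if "x \<in> space P" for c :: "'b \<Rightarrow> real" and x
    unfolding ind[OF that] using S XS[OF that] by (simp add: if_distrib sum.delta cong: if_cong)
  have "AE x in P. real_cond_exp P ?F (\<lambda>y. f (X y) (Y y)) x = ?g (X x)"
  proof (rule real_cond_exp_charact)
    show "integrable P (\<lambda>y. f (X y) (Y y))"
      using intf[of f] by (rule Bochner_Integration.integrable_cong[THEN iffD1, rotated 2])
        (simp_all add: sum_f)
    show "integrable P (\<lambda>x. ?g (X x))"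
      using intg[of ?g] by (rule Bochner_Integration.integrable_cong[THEN iffD1, rotated 2])
        (simp_all only: sum_g)
    show "(\<lambda>x. ?g (X x)) \<in> borel_measurable ?F"
      by (rule measurable_compose[OF measurable_vimage_algebra1]) (use XS in auto)
  next
    \<comment> \<open>Events of \<open>?F\<close> say that \<open>X\<close> lies in some
      \<open>U\<close>, so restricting an integral to \<open>E\<close> multiplies the coefficients
      by \<open>indicator U s\<close>.\<close>
    fix E assume "E \<in> sets ?F"
    then obtain U where E: "E = X -` U \<inter> space P" unfolding sets_F by auto
    have "(\<integral>x\<in>E. f (X x) (Y x) \<partial>P)
        = (\<integral>x. (\<Sum>s\<in>S. \<Sum>t\<in>T. (indicator U s * f s t) * indicator (?A s \<inter> ?B t) x) \<partial>P)"
      unfolding set_lebesgue_integral_def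
    proof (rule Bochner_Integration.integral_cong[OF refl])
      fix x assume x: "x \<in> space P"
      show "indicator E x *\<^sub>R f (X x) (Y x)
          = (\<Sum>s\<in>S. \<Sum>t\<in>T. (indicator U s * f s t) * indicator (?A s \<inter> ?B t) x)"
        unfolding sum_f[OF x] using x by (auto simp: E indicator_def)
    qed
    also have "\<dots> = (\<Sum>s\<in>S. \<Sum>t\<in>T. (indicator U s * f s t) * (prob (?A s) / card T))"
      unfolding valf by (intro sum.cong refl) (simp only: prob_AB)
    also have "\<dots> = (\<Sum>s\<in>S. (indicator U s * ?g s) * prob (?A s))"
      by (intro sum.cong refl)
        (simp add: sum_distrib_left sum_distrib_right sum_divide_distrib algebra_simps)
    also have "\<dots> = (\<integral>x. (\<Sum>s\<in>S. (indicator U s * ?g s) * indicator (?A s) x) \<partial>P)"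
      by (rule valg[symmetric])
    also have "\<dots> = (\<integral>x\<in>E. ?g (X x) \<partial>P)"
      unfolding set_lebesgue_integral_def
    proof (rule Bochner_Integration.integral_cong[OF refl])
      fix x assume x: "x \<in> space P"
      show "(\<Sum>s\<in>S. (indicator U s * ?g s) * indicator (?A s) x) = indicator E x *\<^sub>R ?g (X x)"
        unfolding sum_g[OF x] using x by (auto simp: E indicator_def)
    qed
    finally show "(\<integral>x\<in>E. f (X x) (Y x) \<partial>P) = (\<integral>x\<in>E. ?g (X x) \<partial>P)" .
  qed
  then show ?thesis by (simp add: cond_exp_given_def)
qed

section \<open>Convergence in probability\<close>

text \<open>Markov's inequality by counting matchings. The number of ordered overlaps never exceeds
  \<open>T\<close>, and \<open>T / M\<close> lies within \<epsilon>/2 of \<open>c\<close>, so a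
  deviation above \<epsilon> can only be downward and costs a deficit of at least \<epsilon> M /
  2.\<close>

lemma uniform_matching_prob_deviation_le:
  fixes N M K :: nat and dl dr :: "nat \<Rightarrow> nat" and P :: "'a measure" and c \<epsilon> :: real
  defines "W \<equiv> matchings N dl M dr" and "h \<equiv> card (half_edges N dl)"
    and "T \<equiv> real (card (sibling_pairs N dl))"
  assumes degree_sum: "(\<Sum>v=1..N. dl v) = (\<Sum>a=1..M. dr a)" and M: "M \<ge> 1"
    and \<omega>: "\<omega> \<in> measurable P (count_space W)"
    and unif: "distr P (count_space W) \<omega> = uniform_count_measure W"
    and h: "h \<ge> 6" and \<epsilon>: "\<epsilon> > 0" and close: "\<bar>T / M - c\<bar> < \<epsilon> / 2"
  shows "measure P {x \<in> space P. \<bar>2 * real (card (overlapping_pairs N dl M dr (\<omega> x))) / M - c\<bar> > \<epsilon>}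
    \<le> 2 / \<epsilon> * (((\<Sum>v | v \<in> {1..N} \<and> dl v > K. (real (dl v))\<^sup>2)
        + 2 * T * (\<Sum>a | a \<in> {1..M} \<and> dr a > K. real (dr a)) / h
        + 2 * real K ^ 2 + 10 * real K ^ 4) / M)"
    (is "_ \<le> 2 / \<epsilon> * (?B / M)")
proof -
  let ?X = "\<lambda>w. real (card (ordered_overlapping_pairs N dl M dr w))"
  define U where "U = {w \<in> W. \<bar>?X w / M - c\<bar> > \<epsilon>}"
  have finW: "finite W" unfolding W_def by (rule finite_matchings[OF degree_sum])
  have finU: "finite U" using finW by (simp add: U_def)
  have card_W: "real (card W) = fact h" unfolding W_def h_def by (simp add: card_matchings[OF degree_sum])
  have eq: "2 * real (card (overlapping_pairs N dl M dr w)) = ?X w" for w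
    by (simp add: card_ordered_eq_twice_overlapping)
  have XT: "?X w \<le> T" if "w \<in> W" for w
    using card_ordered_overlapping_pairs_le[of w N dl M dr] that by (simp add: W_def T_def)
  have \<omega>W: "\<omega> x \<in> W" if "x \<in> space P" for x using measurable_space[OF \<omega> that] by simp
  have "{x \<in> space P. \<bar>2 * real (card (overlapping_pairs N dl M dr (\<omega> x))) / M - c\<bar> > \<epsilon>}
      = \<omega> -` U \<inter> space P"
    unfolding eq U_def using \<omega>W by auto
  also have "measure P \<dots> = measure (distr P (count_space W) \<omega>) U"
    by (rule measure_distr[symmetric, OF \<omega>]) (auto simp: U_def)
  also have "\<dots> = card U / fact h"
    unfolding unif using finW by (subst measure_uniform_count_measure) (auto simp: U_def card_W)
  also have "\<dots> \<le> 2 / \<epsilon> * (?B / M)"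
  proof -
    have "real (card U) * (\<epsilon> / 2 * M) = (\<Sum>w\<in>U. \<epsilon> / 2 * M)" by simp
    also have "\<dots> \<le> (\<Sum>w\<in>U. T - ?X w)"
    proof (rule sum_mono)
      fix w assume w: "w \<in> U"
      have "?X w / M \<le> T / M" using XT[of w] w by (intro divide_right_mono) (auto simp: U_def)
      moreover have "\<bar>?X w / M - c\<bar> > \<epsilon>" using w by (simp add: U_def)
      ultimately have "\<epsilon> / 2 \<le> T / M - ?X w / M" using close by linarith
      then show "\<epsilon> / 2 * M \<le> T - ?X w" using M by (simp add: field_simps)
    qed
    also have "\<dots> \<le> (\<Sum>w\<in>W. T - ?X w)"
      by (rule sum_mono2[OF finW]) (use XT in \<open>auto simp: U_def\<close>)
    also have "\<dots> \<le> fact h * ?B"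
      unfolding W_def T_def h_def
      by (rule sum_card_sibling_pairs_minus_overlapping_le[OF degree_sum])
        (use h in \<open>simp add: h_def\<close>)
    finally have "real (card U) * (\<epsilon> / 2 * M) \<le> fact h * ?B" .
    then have "real (card U) \<le> fact h * ?B / (\<epsilon> / 2 * M)"
      using \<epsilon> M by (subst pos_le_divide_eq) auto
    then have "card U / fact h \<le> fact h * ?B / (\<epsilon> / 2 * M) / fact h"
      by (rule divide_right_mono) simp
    also have "\<dots> = ?B / (\<epsilon> / 2 * M)" by simp
    also have "\<dots> = 2 / \<epsilon> * (?B / M)" using \<epsilon> M by (simp add: field_simps)
    finally show ?thesis .
  qed
  finally show ?thesis .
qed

text \<open>An iterated limit: fix \<open>K\<close> with \<open>e K < a\<close>, then let
  \<open>n\<close> grow until \<open>r K n\<close> is below \<open>a\<close> as well.\<close>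

lemma tendsto_0_by_truncation:
  fixes f :: "nat \<Rightarrow> real"
  assumes "\<And>n. f n \<ge> 0" and "\<And>K. \<forall>\<^sub>F n in sequentially. f n \<le> r K n"
    and "\<And>K. r K \<longlonglongrightarrow> e K" and "e \<longlonglongrightarrow> (0::real)"
  shows "f \<longlonglongrightarrow> 0"
proof (rule order_tendstoI)
  fix a :: real assume "a > 0"
  then obtain K :: nat where "e K < a"
    using order_tendstoD(2)[OF assms(4)] by (metis eventually_sequentially order_refl)
  from assms(2)[of K] order_tendstoD(2)[OF assms(3) this]
  show "\<forall>\<^sub>F n in sequentially. f n < a" by eventually_elim simp
qed (use assms(1) in \<open>auto intro: always_eventually less_le_trans\<close>)

lemma finite_graphs_of_size: "finite {H \<in> Collect admissible. gsize H = k}"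
proof (rule finite_subset)
  show "{H \<in> Collect admissible. gsize H = k} \<subseteq> {k} \<times> Pow (Pow {1..k})"
    by (auto simp: admissible_def simple_graph_def)
qed simp

text \<open>Only finitely many admissible graphs have size \<open>k\<close>, so the convergence of
  the individual graph frequencies can be summed.\<close>

lemma community_size_pmf_tendsto:
  assumes \<H>: "\<H> \<subseteq> Collect admissible" and M: "\<And>n. M n \<ge> 1"
    and Com: "\<And>n a. a \<in> {1..M n} \<Longrightarrow> Com n a \<in> \<H>"
    and supp: "set_pmf \<mu> \<subseteq> \<H>"
    and lim: "\<And>H. H \<in> \<H> \<Longrightarrow>
      (\<lambda>n. real (card {a \<in> {1..M n}. Com n a = H}) / real (M n)) \<longlonglongrightarrow> pmf \<mu> H"
  shows "(\<lambda>n. pmf (degree_law (M n) (\<lambda>a. gsize (Com n a))) k) \<longlonglongrightarrow> pmf (map_pmf gsize \<mu>) k"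
proof -
  define G where "G = {H \<in> \<H>. gsize H = k}"
  have fin: "finite G"
    by (rule finite_subset[OF _ finite_graphs_of_size[of k]]) (use \<H> in \<open>auto simp: G_def\<close>)
  have "pmf (map_pmf gsize \<mu>) k = measure_pmf.prob \<mu> {H. gsize H = k}"
    by (simp add: pmf_map vimage_def)
  also have "\<dots> = measure_pmf.prob \<mu> G"
    by (rule measure_pmf.finite_measure_eq_AE)
      (use supp in \<open>auto simp: AE_measure_pmf_iff G_def\<close>)
  also have "\<dots> = (\<Sum>H\<in>G. pmf \<mu> H)" by (rule measure_measure_pmf_finite[OF fin])
  finally have limit: "pmf (map_pmf gsize \<mu>) k = (\<Sum>H\<in>G. pmf \<mu> H)" .
  have "pmf (degree_law (M n) (\<lambda>a. gsize (Com n a))) k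
      = (\<Sum>H\<in>G. real (card {a \<in> {1..M n}. Com n a = H}) / real (M n))" for n
  proof -
    have "{a \<in> {1..M n}. gsize (Com n a) = k} = (\<Union>H\<in>G. {a \<in> {1..M n}. Com n a = H})"
      using Com by (auto simp: G_def)
    also have "card \<dots> = (\<Sum>H\<in>G. card {a \<in> {1..M n}. Com n a = H})"
      by (rule card_UN_disjoint) (use fin in auto)
    finally show ?thesis
      unfolding pmf_degree_law[OF M] by (simp add: sum_divide_distrib)
  qed
  then show ?thesis
    unfolding limit by (simp only:) (intro tendsto_sum lim, simp add: G_def)
qed

theorem proposition2p12:
  fixes N M :: "nat \<Rightarrow> nat"
    and dl :: "nat \<Rightarrow> nat \<Rightarrow> nat"
    and \<H> :: "com_graph set"
    and Com :: "nat \<Rightarrow> nat \<Rightarrow> com_graph"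
    and dr :: "nat \<Rightarrow> nat \<Rightarrow> nat"
    and P :: "nat \<Rightarrow> 'a measure"
    and \<omega> :: "nat \<Rightarrow> 'a \<Rightarrow> matching"
    and V :: "nat \<Rightarrow> 'a \<Rightarrow> nat"
    and Dl Dr Dl_tilde :: "nat pmf"
    and \<mu> :: "com_graph pmf"
  assumes N_pos: "\<And>n. N n \<ge> 1" and N_lim: "filterlim N at_top sequentially"
    and M_pos: "\<And>n. M n \<ge> 1" and M_lim: "filterlim M at_top sequentially"
    and dl_pos: "\<And>n v. v \<in> {1..N n} \<Longrightarrow> dl n v \<ge> 1"
    and \<H>: "iso_representatives \<H>"
    and Com: "\<And>n a. a \<in> {1..M n} \<Longrightarrow> Com n a \<in> \<H>"
    and dr: "\<And>n a. dr n a = gsize (Com n a)"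
    and half_edge_count: "\<And>n. (\<Sum>v=1..N n. dl n v) = (\<Sum>a=1..M n. dr n a)"
    and prob: "\<And>n. prob_space (P n)"
    and \<omega>_meas: "\<And>n. \<omega> n \<in> measurable (P n) (count_space (matchings (N n) (dl n) (M n) (dr n)))"
    and \<omega>_unif: "\<And>n. distr (P n) (count_space (matchings (N n) (dl n) (M n) (dr n))) (\<omega> n)
                     = uniform_count_measure (matchings (N n) (dl n) (M n) (dr n))"
    and V_meas: "\<And>n. V n \<in> measurable (P n) (count_space {1..M n})"
    and V_unif: "\<And>n. distr (P n) (count_space {1..M n}) (V n) = uniform_count_measure {1..M n}"
    and indep: "\<And>n. indep_elements (P n)
                       (count_space (matchings (N n) (dl n) (M n) (dr n))) (\<omega> n)
                       (count_space {1..M n}) (V n)"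
    and A: "conv_in_distribution (\<lambda>n. degree_law (N n) (dl n)) Dl"
    and B_fin: "integrable (measure_pmf Dl) real"
    and B: "(\<lambda>n. measure_pmf.expectation (degree_law (N n) (dl n)) real)
              \<longlonglongrightarrow> measure_pmf.expectation Dl real"
    and C_supp: "set_pmf \<mu> \<subseteq> \<H>"
    and C: "\<And>H. H \<in> \<H> \<Longrightarrow>
              (\<lambda>n. real (card {a \<in> {1..M n}. Com n a = H}) / real (M n)) \<longlonglongrightarrow> pmf \<mu> H"
    and Dr: "Dr = map_pmf gsize \<mu>"
    and D_fin: "integrable (measure_pmf Dr) real"
    and D: "(\<lambda>n. measure_pmf.expectation (degree_law (M n) (dr n)) real)
              \<longlonglongrightarrow> measure_pmf.expectation Dr real"
    and second_fin: "integrable (measure_pmf Dl) (\<lambda>k. (real k)\<^sup>2)"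
    and second: "(\<lambda>n. measure_pmf.expectation (degree_law (N n) (dl n)) (\<lambda>k. (real k)\<^sup>2))
              \<longlonglongrightarrow> measure_pmf.expectation Dl (\<lambda>k. (real k)\<^sup>2)"
    and Dl_tilde: "\<And>k. pmf Dl_tilde k
              = (real k + 1) * pmf Dl (k + 1) / measure_pmf.expectation Dl real"
  shows "(\<forall>n. AE x in P n.
            2 * real (card (overlapping_pairs (N n) (dl n) (M n) (dr n) (\<omega> n x))) / real (M n)
            = cond_exp_given (P n) (count_space (matchings (N n) (dl n) (M n) (dr n))) (\<omega> n)
                (\<lambda>y. real (card (neighbours (N n) (dl n) (M n) (dr n) (\<omega> n y) (V n y)))) x)
       \<and> conv_in_probability P
            (\<lambda>n x. 2 * real (card (overlapping_pairs (N n) (dl n) (M n) (dr n) (\<omega> n x))) / real (M n))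
            (measure_pmf.expectation Dr real * measure_pmf.expectation Dl_tilde real)"
proof (intro conjI allI)
  fix n
  have "AE x in P n. cond_exp_given (P n) (count_space (matchings (N n) (dl n) (M n) (dr n))) (\<omega> n)
      (\<lambda>y. real (card (neighbours (N n) (dl n) (M n) (dr n) (\<omega> n y) (V n y)))) x
    = (\<Sum>a=1..M n. real (card (neighbours (N n) (dl n) (M n) (dr n) (\<omega> n x) a))) / card {1..M n}"
    by (rule AE_cond_exp_given_independent_uniform[OF prob finite_matchings[OF half_edge_count]
        finite_atLeastAtMost \<omega>_meas V_meas V_unif indep])
  \<comment> \<open>Both sides count the ordered overlapping pairs, once by their first community
    and once as twice the unordered pairs.\<close>
  moreover have "(\<Sum>a=1..M n. real (card (neighbours (N n) (dl n) (M n) (dr n) w a)))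
      = 2 * real (card (overlapping_pairs (N n) (dl n) (M n) (dr n) w))" for w
    using card_ordered_overlapping_pairs[of "N n" "dl n" "M n" "dr n" w]
      card_ordered_eq_twice_overlapping[of "N n" "dl n" "M n" "dr n" w]
    by (simp flip: of_nat_sum)
  ultimately show "AE x in P n.
      2 * real (card (overlapping_pairs (N n) (dl n) (M n) (dr n) (\<omega> n x))) / real (M n)
      = cond_exp_given (P n) (count_space (matchings (N n) (dl n) (M n) (dr n))) (\<omega> n)
          (\<lambda>y. real (card (neighbours (N n) (dl n) (M n) (dr n) (\<omega> n y) (V n y)))) x"
    by (simp add: eq_commute[of _ "cond_exp_given _ _ _ _ _"])
next
  define h where "h n = card (half_edges (N n) (dl n))" for n
  define T where "T n = real (card (sibling_pairs (N n) (dl n)))" for n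
  let ?El = "measure_pmf.expectation Dl real" and ?Er = "measure_pmf.expectation Dr real"
    and ?E2 = "measure_pmf.expectation Dl (\<lambda>k. (real k)\<^sup>2)"
  \<comment> \<open>\<open>c\<close> is the form in which the limit of \<open>T n / M n\<close>
    arises; \<open>c_eq\<close> identifies it with the claimed limit through the size-biased
    mean.\<close>
  define c where "c = ?Er * ((?E2 - ?El) / ?El)"
  have h_l: "real (h n) = (\<Sum>v=1..N n. real (dl n v))" for n
    by (simp add: h_def card_half_edges)
  have h_r: "real (h n) = (\<Sum>a=1..M n. real (dr n a))" for n
    using half_edge_count[of n] by (simp add: h_def card_half_edges flip: of_nat_sum)
  have \<H>_adm: "\<H> \<subseteq> Collect admissible" using \<H> by (simp add: iso_representatives_def)
  have dr_pos: "dr n a \<ge> 1" if "a \<in> {1..M n}" for n a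
    using Com[OF that] \<H>_adm by (auto simp: dr admissible_def)
  have h_ge_N: "real (N n) \<le> h n" for n
    unfolding h_l using sum_mono[of "{1..N n}" "\<lambda>_. 1" "\<lambda>v. real (dl n v)"] dl_pos by simp
  have h_ge_M: "real (M n) \<le> h n" for n
    unfolding h_r using sum_mono[of "{1..M n}" "\<lambda>_. 1" "\<lambda>a. real (dr n a)"] dr_pos by simp
  have hN: "(\<lambda>n. h n / N n) \<longlonglongrightarrow> ?El"
    using B unfolding expectation_degree_law[OF N_pos] by (simp add: h_l)
  have hM: "(\<lambda>n. h n / M n) \<longlonglongrightarrow> ?Er"
    using D unfolding expectation_degree_law[OF M_pos] by (simp add: h_r)
  \<comment> \<open>Every individual has a half-edge, so \<open>h n / N n\<close> and its limit are
    at least 1; this justifies the later divisions by \<open>?El\<close>.\<close>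
  have "?El \<ge> 1"
  proof (rule LIMSEQ_le_const[OF hN], intro exI allI impI)
    show "1 \<le> h n / N n" for n using h_ge_N[of n] N_pos[of n] by (simp add: le_divide_eq)
  qed
  then have El_pos: "?El > 0" by simp
  have T_eq: "T n = (\<Sum>v=1..N n. (real (dl n v))\<^sup>2) - h n" for n
  proof -
    have "real (dl n v * (dl n v - 1)) = (real (dl n v))\<^sup>2 - real (dl n v)" for v
      by (cases "dl n v") (auto simp: power2_eq_square algebra_simps)
    then show ?thesis by (simp add: T_def h_l card_sibling_pairs sum_subtractf del: of_nat_mult)
  qed
  have TN: "(\<lambda>n. T n / N n) \<longlonglongrightarrow> ?E2 - ?El"
    unfolding T_eq diff_divide_distrib
    using second hN unfolding expectation_degree_law[OF N_pos] by (rule tendsto_diff)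
  have h_nz: "real (h n) \<noteq> 0" and N_nz: "real (N n) \<noteq> 0" for n
    using h_ge_N[of n] N_pos[of n] by auto
  have Th: "(\<lambda>n. T n / h n) \<longlonglongrightarrow> (?E2 - ?El) / ?El"
  proof -
    have "(\<lambda>n. (T n / N n) / (h n / N n)) \<longlonglongrightarrow> (?E2 - ?El) / ?El"
      using El_pos by (intro tendsto_divide TN hN) simp
    moreover have "(T n / N n) / (h n / N n) = T n / h n" for n using N_nz[of n] by simp
    ultimately show ?thesis by (simp only:)
  qed
  have TM: "(\<lambda>n. T n / M n) \<longlonglongrightarrow> c"
  proof -
    have "(\<lambda>n. (h n / M n) * (T n / h n)) \<longlonglongrightarrow> c" unfolding c_def by (intro tendsto_mult hM Th)
    moreover have "(h n / M n) * (T n / h n) = T n / M n" for n using h_nz[of n] by simp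
    ultimately show ?thesis by (simp only:)
  qed
  \<comment> \<open>Counting half-edges from both sides fixes the ratio of individuals to
    communities. It converts the tail over individuals, normalised by \<open>N n\<close>, to the
    normalisation \<open>M n\<close> of the bound.\<close>
  have NM: "(\<lambda>n. N n / M n) \<longlonglongrightarrow> ?Er / ?El"
  proof -
    have "(\<lambda>n. (h n / M n) / (h n / N n)) \<longlonglongrightarrow> ?Er / ?El"
      using El_pos by (intro tendsto_divide hN hM) simp
    moreover have "(h n / M n) / (h n / N n) = N n / M n" for n using h_nz[of n] by simp
    ultimately show ?thesis by (simp only:)
  qed
  \<comment> \<open>Sibling pairs are quadratic in the degree of their individual, hence a
    second-moment tail for \<open>Dl\<close>; a half-edge landing in a large community costs only a
    first-moment tail of \<open>Dr\<close>.\<close>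
  define tl where "tl K = measure_pmf.expectation Dl (\<lambda>k. (real k)\<^sup>2 * indicator {K<..} k)" for K
  define tr where "tr K = measure_pmf.expectation Dr (\<lambda>k. real k * indicator {K<..} k)" for K
  have tail_l: "(\<lambda>n. (\<Sum>v | v \<in> {1..N n} \<and> dl n v > K. (real (dl n v))\<^sup>2) / N n) \<longlonglongrightarrow> tl K" for K
    using expectation_tail_tendsto[OF conv_in_distribution_imp_pmf[OF A]
        integrable_degree_law[OF N_pos] second_fin second, of K]
    unfolding expectation_degree_law_tail[OF N_pos] tl_def .
  have pmf_r: "(\<lambda>n. pmf (degree_law (M n) (dr n)) k) \<longlonglongrightarrow> pmf Dr k" for k
  proof -
    have "dr n = (\<lambda>a. gsize (Com n a))" for n by (rule ext) (rule dr)
    then show ?thesis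
      using community_size_pmf_tendsto[OF \<H>_adm M_pos Com C_supp C, of k] by (simp only: Dr)
  qed
  have tail_r: "(\<lambda>n. (\<Sum>a | a \<in> {1..M n} \<and> dr n a > K. real (dr n a)) / M n) \<longlonglongrightarrow> tr K" for K
    using expectation_tail_tendsto[OF pmf_r integrable_degree_law[OF M_pos] D_fin D, of K]
    unfolding expectation_degree_law_tail[OF M_pos] tr_def .
  define const where "const K = 2 * real K ^ 2 + 10 * real K ^ 4" for K
  \<comment> \<open>\<open>r K n\<close> is the Markov bound without its factor 2/\<epsilon>. At
    fixed \<open>K\<close> the term \<open>const K\<close> is divided by \<open>M n\<close> and
    leaves no trace in \<open>e K\<close>.\<close>
  define r where "r K n = ((\<Sum>v | v \<in> {1..N n} \<and> dl n v > K. (real (dl n v))\<^sup>2)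
        + 2 * T n * (\<Sum>a | a \<in> {1..M n} \<and> dr n a > K. real (dr n a)) / h n + const K) / M n" for K n
  define e where "e K = ?Er / ?El * tl K + 2 * ((?E2 - ?El) / ?El) * tr K" for K
  have M_real: "filterlim (\<lambda>n. real (M n)) at_top sequentially"
    by (rule filterlim_compose[OF filterlim_real_sequentially M_lim])
  have r_lim: "r K \<longlonglongrightarrow> e K" for K
  proof -
    have "(\<lambda>n. N n / M n * ((\<Sum>v | v \<in> {1..N n} \<and> dl n v > K. (real (dl n v))\<^sup>2) / N n)
        + 2 * (T n / h n) * ((\<Sum>a | a \<in> {1..M n} \<and> dr n a > K. real (dr n a)) / M n)
        + const K / M n) \<longlonglongrightarrow> e K + 0"
      unfolding e_def
      by (intro tendsto_add tendsto_mult tendsto_const NM tail_l Th tail_r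
          real_tendsto_divide_at_top[OF tendsto_const M_real])
    moreover have "N n / M n * ((\<Sum>v | v \<in> {1..N n} \<and> dl n v > K. (real (dl n v))\<^sup>2) / N n)
        + 2 * (T n / h n) * ((\<Sum>a | a \<in> {1..M n} \<and> dr n a > K. real (dr n a)) / M n)
        + const K / M n = r K n" for n
      using N_nz[of n] by (simp add: r_def add_divide_distrib)
    ultimately show ?thesis by simp
  qed
  have e_lim: "e \<longlonglongrightarrow> 0"
  proof -
    have "(\<lambda>K. ?Er / ?El * tl K + 2 * ((?E2 - ?El) / ?El) * tr K)
        \<longlonglongrightarrow> ?Er / ?El * 0 + 2 * ((?E2 - ?El) / ?El) * 0"
      unfolding tl_def tr_def
      by (intro tendsto_add tendsto_mult tendsto_const expectation_tail_tendsto_0 second_fin D_fin)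
    then show ?thesis by (simp add: e_def[abs_def])
  qed
  \<comment> \<open>Brings \<open>n\<close> into the range of the factorial ratios, since there are
    at least as many half-edges as communities.\<close>
  have h_large: "\<forall>\<^sub>F n in sequentially. h n \<ge> 6"
    using filterlim_at_top[THEN iffD1, OF M_lim, rule_format, of 6]
  proof eventually_elim
    case (elim n)
    then show ?case using h_ge_M[of n] by linarith
  qed
  have c_eq: "?Er * measure_pmf.expectation Dl_tilde real = c"
    unfolding c_def expectation_size_biased[OF second_fin Dl_tilde]
    by (simp add: Bochner_Integration.integral_diff[OF second_fin B_fin])
  show "conv_in_probability P
      (\<lambda>n x. 2 * real (card (overlapping_pairs (N n) (dl n) (M n) (dr n) (\<omega> n x))) / real (M n))
      (?Er * measure_pmf.expectation Dl_tilde real)"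
    unfolding conv_in_probability_def c_eq
  proof (intro conjI allI impI)
    fix n
    show "(\<lambda>x. 2 * real (card (overlapping_pairs (N n) (dl n) (M n) (dr n) (\<omega> n x))) / real (M n))
        \<in> borel_measurable (P n)"
      by (rule measurable_compose[OF \<omega>_meas]) simp
  next
    fix \<epsilon> :: real assume \<epsilon>: "\<epsilon> > 0"
    let ?p = "\<lambda>n. measure (P n) {x \<in> space (P n).
      \<bar>2 * real (card (overlapping_pairs (N n) (dl n) (M n) (dr n) (\<omega> n x))) / real (M n) - c\<bar> > \<epsilon>}"
    show "?p \<longlonglongrightarrow> 0"
    proof (rule tendsto_0_by_truncation)
      have close: "\<forall>\<^sub>F n in sequentially. \<bar>T n / M n - c\<bar> < \<epsilon> / 2"
        using tendstoD[OF TM, of "\<epsilon> / 2"] \<epsilon> by (simp add: dist_real_def)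
      show "\<forall>\<^sub>F n in sequentially. ?p n \<le> 2 / \<epsilon> * r K n" for K
        using h_large close
      proof eventually_elim
        case (elim n)
        show ?case
          using uniform_matching_prob_deviation_le[OF half_edge_count M_pos \<omega>_meas \<omega>_unif
              elim(1)[unfolded h_def] \<epsilon> elim(2)[unfolded T_def], of K]
          unfolding r_def T_def h_def const_def by (simp only: add.assoc)
      qed
      show "(\<lambda>n. 2 / \<epsilon> * r K n) \<longlonglongrightarrow> 2 / \<epsilon> * e K" for K
        by (intro tendsto_mult tendsto_const r_lim)
      show "(\<lambda>K. 2 / \<epsilon> * e K) \<longlonglongrightarrow> 0"
        using tendsto_mult[OF tendsto_const[of "2 / \<epsilon>"] e_lim] by simp
    qed simp
  qed
qed

end
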